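(* Let $a>0$, $x>0$, $0<\theta,\psi<1$, let $k\geq 2$ be an even integer, and let $\nu\in\mathbb{C}$ with $\Re(\nu)>0$. Then \begin{align*} &\left(\frac{a^2x}{4}\right)^{\frac{\nu}{2}+k+1}\sum_{n=1}^{\infty} n^{\nu/2}K_{\nu}(a\sqrt{nx})\sum_{d\mid n}d^k\cos(2\pi d\theta)\sin\left(\frac{2\pi n\psi}{d}\right)\\ &=\frac{(-1)^{k/2}(2\pi)^{k+1}}{8}\Gamma(\nu+k+1)\sum_{m,n\geq 0}\left\{\frac{(n+\psi)^k}{\left(\frac{16\pi^2}{a^2}\frac{(n+\psi)(m+\theta)}{x}+1\right)^{\nu+k+1}}-\frac{(n+1-\psi)^k}{\left(\frac{16\pi^2}{a^2}\frac{(n+1-\psi)(m+\theta)}{x}+1\right)^{\nu+k+1}}\right.\\ &\qquad\left.-\frac{(n+1-\psi)^k}{\left(\frac{16\pi^2}{a^2}\frac{(n+1-\psi)(m+1-\theta)}{x}+1\right)^{\nu+k+1}}+\frac{(n+\psi)^k}{\left(\frac{16\pi^2}{a^2}\frac{(n+\psi)(m+1-\theta)}{x}+1\right)^{\nu+k+1}}\right\}. \end{align*}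
   Context: $K_\nu$ denotes the modified Bessel function of the second kind of order $\nu$. The double sum runs over all pairs of non-negative integers $m,n$. *)

theory Defs
  imports "HOL-Analysis.Analysis"
begin

text \<open>Modified Bessel function of the second kind, via the standard integral
representation K_nu(z) = integral over t from 0 to infinity of exp(-z cosh t) cosh(nu t),
valid for every complex order nu and every z > 0.\<close>
definition besselK :: "complex \<Rightarrow> real \<Rightarrow> complex" where
  "besselK \<nu> z = integral {0..} (\<lambda>t::real. exp (- z * cosh t) *\<^sub>R cosh (\<nu> * of_real t))"

end

theory Submission
  imports Defs
begin

text \<open>
Put \<open>X = a\<^sup>2 x / 4\<close>. After the substitution \<open>t = e\<^sup>\<tau>\<close>, \<open>n\<close> to the power \<open>\<nu>/2\<close> times \<open>K\<^sub>\<nu>(a \<surd>(n x))\<close> is, up to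
a constant, the integral over the real line of \<open>exp (\<nu> \<tau> - exp \<tau> - n X exp (-\<tau>))\<close>. Summing over \<open>n\<close>
under the integral produces, with \<open>s = X exp (-\<tau>)\<close>, the double series of
\<open>d\<^sup>k cos (2\<pi>d\<theta>) sin (2\<pi>e\<psi>) exp (-d e s)\<close>. Lipschitz's formula (the Fourier series in \<open>t\<close> of the sum over \<open>n\<close>
of \<open>(n + t)\<^sup>k exp (-(n + t) y)\<close>), applied once to the sum over \<open>d\<close> and once backwards to the sum over \<open>e\<close>,
turns it into \<open>s\<close> to the power \<open>-k-1\<close> times the double series of \<open>u\<^sup>k exp (-4\<pi>\<^sup>2 u v / s)\<close>. Integrating this termwise gives
Gamma integrals with values \<open>u\<^sup>k \<Gamma>(\<nu>+k+1)\<close> over \<open>1 + 4\<pi>\<^sup>2 u v / X\<close> to the power \<open>\<nu>+k+1\<close>.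
\<close>

section \<open>Fourier series\<close>

text \<open>The two uses of Lipschitz's formula differ in where the parameter sits. For the sum over
  d, \<theta> enters as the imaginary part of y with shift t = 0; for the sum over e, \<psi> is the
  shift t and y is real. They meet in the double series over e and n of sin (2 pi e \<psi>) times
  the real part of (e s + 2 pi i v) to the power -(k+1), with v = n + \<theta> or n + 1 - \<theta>.
  By the inequality of the arithmetic and geometric mean it is dominated by a product of powers with
  exponent -(k+1)/2 in each index, so k >= 2 gives absolute convergence and lets the order of
  summation be reversed. Evenness of k makes the power i^(k+1) purely imaginary: this exchanges sine
  and cosine type sums and produces the sign (-1)^(k/2). In the final integration Re \<nu> > 0
  supplies the exponent Re \<nu> + 1 > 1 that is needed for absolute convergence in u. On the
  logarithmic scale every rescaling of a Gamma or Bessel integral is a translation of the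
  line.\<close>

lemma continuous_on_circle_quotient:
  fixes u :: "real \<Rightarrow> complex"
  assumes cont: "continuous_on {0..1} u" and per: "u 0 = u 1"
  obtains G where "continuous_on (sphere 0 1) G" "\<And>t. t \<in> {0..1} \<Longrightarrow> G (cis (2 * pi * t)) = u t"
proof -
  define q where "q = (\<lambda>t::real. cis (2 * pi * t))"
  define G where "G = (\<lambda>z. u (Arg2pi z / (2 * pi)))"
  have contq: "continuous_on {0..1} q"
    unfolding q_def by (intro continuous_intros)
  have G: "G (q t) = u t" if "t \<in> {0..1}" for t
  proof (cases "t = 1")
    case True
    then show ?thesis using per Arg2pi_of_real[of 1] by (simp add: G_def q_def)
  next
    case False
    have "Arg2pi (cis (2 * pi * t)) = 2 * pi * t"
      using that False by (intro Arg2pi_unique[of 1]) (auto simp: cis_conv_exp)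
    then show ?thesis by (simp add: G_def q_def)
  qed
  have img: "q ` {0..1} = sphere 0 1"
  proof
    show "sphere 0 1 \<subseteq> q ` {0..1}"
    proof
      fix z :: complex assume z: "z \<in> sphere 0 1"
      have "Arg2pi z / (2 * pi) \<in> {0..1}"
        using Arg2pi_ge_0[of z] Arg2pi_lt_2pi[of z] by (auto simp: divide_simps)
      moreover have "z = q (Arg2pi z / (2 * pi))"
        using Arg2pi[of z] z by (simp add: q_def cis_conv_exp is_Arg_def)
      ultimately show "z \<in> q ` {0..1}" by blast
    qed
  qed (auto simp: q_def)
  have "continuous_on (sphere 0 1) G"
    unfolding continuous_on_open_gen[OF subset_UNIV[THEN image_subset_iff_funcset[THEN iffD1]]]
  proof (intro allI impI)
    fix U :: "complex set" assume U: "openin (top_of_set UNIV) U"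
    have eq: "{0..1} \<inter> q -` (sphere 0 1 \<inter> G -` U) = {0..1} \<inter> u -` U"
      using img G by auto
    have "openin (top_of_set {0..1}) ({0..1} \<inter> u -` U)"
      using cont U by (simp add: continuous_on_open_gen continuous_openin_preimage_gen)
    \<comment> \<open>A continuous map from a compact space onto a Hausdorff space is a quotient
      map, so openness of the preimage in the interval suffices. Composing continuous maps would
      fail, since \<open>Arg2pi\<close> jumps at 1.\<close>
    then show "openin (top_of_set (sphere 0 1)) (sphere 0 1 \<inter> G -` U)"
      using Abstract_Topology_2.continuous_imp_quotient_map[OF contq img compact_Icc, of "sphere 0 1 \<inter> G -` U"] eq by simp
  qed
  with G that show ?thesis by (auto simp: q_def)
qed

lemma continuous_on_polynomial_function_cis:
  fixes p :: "complex \<Rightarrow> 'a::euclidean_space"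
  assumes "polynomial_function p"
  shows "continuous_on A (\<lambda>t::real. p (cis (2 * pi * t)))"
  by (rule continuous_on_compose2[OF continuous_on_polymonial_function[OF assms, of UNIV]])
     (auto intro!: continuous_intros)

lemma continuous_on_real_polynomial_function_cis:
  fixes p :: "complex \<Rightarrow> real"
  assumes "real_polynomial_function p"
  shows "continuous_on A (\<lambda>t::real. complex_of_real (p (cis (2 * pi * t))))"
  using continuous_on_polynomial_function_cis[of p] assms
  by (intro continuous_on_of_real) (simp add: real_polynomial_function_eq)

text \<open>Vanishing of all Fourier coefficients is stable under multiplication by trigonometric
  polynomials; stating it for every \<open>u\<close> makes the product case immediate.\<close>
lemma fourier_coeffs_zero_mult_polynomial:
  fixes p :: "complex \<Rightarrow> real" and u :: "real \<Rightarrow> complex"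
  assumes "real_polynomial_function p"
    and "continuous_on {0..1} u"
    and "\<And>n::int. integral {0..1} (\<lambda>t. u t * cis (2 * pi * n * t)) = 0"
  shows "integral {0..1} (\<lambda>t. u t * of_real (p (cis (2 * pi * t))) * cis (2 * pi * of_int n * t)) = 0"
  using assms
proof (induction arbitrary: u n rule: real_polynomial_function.induct)
  case (linear f)
  note lin = bounded_linear.linear[OF linear(1)]
  \<comment> \<open>A real-linear f is determined by its values at 1 and i. On the circle it is a
    combination of \<open>cis\<close> and its conjugate, hence only moves the frequency by one up or
    down.\<close>
  have f: "of_real (f (cis (2 * pi * t))) * cis (2 * pi * n * t)
      = (f 1 - \<i> * f \<i>) / 2 * cis (2 * pi * of_int (n + 1) * t)
        + (f 1 + \<i> * f \<i>) / 2 * cis (2 * pi * of_int (n - 1) * t)" for t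
  proof -
    have "cis (2 * pi * t) = cos (2 * pi * t) *\<^sub>R 1 + sin (2 * pi * t) *\<^sub>R \<i>"
      by (simp add: complex_eq_iff)
    then have "f (cis (2 * pi * t)) = cos (2 * pi * t) * f 1 + sin (2 * pi * t) * f \<i>"
      by (simp only: linear_add[OF lin] linear_cmul[OF lin] real_scaleR_def)
    then have "complex_of_real (f (cis (2 * pi * t))) = (f 1 - \<i> * f \<i>) / 2 * cis (2 * pi * t)
        + (f 1 + \<i> * f \<i>) / 2 * cis (- (2 * pi * t))"
      by (intro complex_eqI) (simp_all add: algebra_simps flip: add_divide_distrib)
    then have "of_real (f (cis (2 * pi * t))) * cis (2 * pi * n * t)
       = (f 1 - \<i> * f \<i>) / 2 * (cis (2 * pi * t) * cis (2 * pi * n * t))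
        + (f 1 + \<i> * f \<i>) / 2 * (cis (- (2 * pi * t)) * cis (2 * pi * n * t))"
      by (simp add: algebra_simps)
    then show ?thesis unfolding cis_mult by (simp add: algebra_simps)
  qed
  have i: "(\<lambda>t. u t * cis (2 * pi * of_int m * t)) integrable_on {0..1}" for m :: int
    using linear(2) by (intro integrable_continuous_real continuous_intros) auto
  have "integral {0..1} (\<lambda>t. u t * of_real (f (cis (2 * pi * t))) * cis (2 * pi * of_int n * t))
     = integral {0..1} (\<lambda>t. (f 1 - \<i> * f \<i>) / 2 * (u t * cis (2 * pi * of_int (n + 1) * t))
        + (f 1 + \<i> * f \<i>) / 2 * (u t * cis (2 * pi * of_int (n - 1) * t)))"
    by (rule integral_cong) (subst mult.assoc, subst f, simp add: algebra_simps)
  also have "\<dots> = 0"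
    using i[of "n + 1"] i[of "n - 1"]
    by (subst integral_add) (simp_all only: integrable_on_mult_right integral_mult_right linear(3) mult_zero_right add_0)
  finally show ?case .
next
  case (const c)
  have "integral {0..1} (\<lambda>t. u t * of_real c * cis (2 * pi * of_int n * t))
     = integral {0..1} (\<lambda>t. of_real c * (u t * cis (2 * pi * of_int n * t)))"
    by (rule integral_cong) (simp only: mult_ac)
  then show ?case by (simp only: integral_mult_right const.prems(2) mult_zero_right)
next
  case (add f g)
  have "integral {0..1} (\<lambda>t. u t * of_real (f (cis (2 * pi * t)) + g (cis (2 * pi * t))) * cis (2 * pi * of_int n * t))
     = integral {0..1} (\<lambda>t. u t * of_real (f (cis (2 * pi * t))) * cis (2 * pi * of_int n * t)
          + u t * of_real (g (cis (2 * pi * t))) * cis (2 * pi * of_int n * t))"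
    by (simp add: algebra_simps)
  also have "\<dots> = 0"
    using add.hyps add.IH[OF add.prems] add.prems(1) by (subst integral_add) (auto intro!: integrable_continuous_real continuous_intros continuous_on_real_polynomial_function_cis)
  finally show ?case .
next
  case (mult f g)
  have "integral {0..1} (\<lambda>t. (u t * of_real (f (cis (2 * pi * t)))) * of_real (g (cis (2 * pi * t))) * cis (2 * pi * of_int n * t)) = 0"
    using mult by (intro mult.IH) (auto intro!: continuous_intros continuous_on_real_polynomial_function_cis)
  then show ?case by (simp add: mult_ac)
qed

text \<open>By Stone-Weierstrass on the circle, the conjugate of u is within e of a polynomial p.
  Since u is orthogonal to p, the integral of |u|^2 equals that of u (cnj u - p), which is at most e
  times the integral of |u|; let e tend to 0.\<close>

lemma fourier_uniqueness:
  fixes u :: "real \<Rightarrow> complex"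
  assumes cont: "continuous_on {0..1} u" and per: "u 0 = u 1"
    and coeff: "\<And>n::int. integral {0..1} (\<lambda>t. u t * cis (2 * pi * n * t)) = 0"
    and t: "t \<in> {0..1}"
  shows "u t = 0"
proof -
  obtain G where G: "continuous_on (sphere 0 1) G" "\<And>t. t \<in> {0..1} \<Longrightarrow> G (cis (2 * pi * t)) = u t"
    using continuous_on_circle_quotient[OF cont per] by blast
  define I where "I = integral {0..1} (\<lambda>t. u t * cnj (u t))"
  define B where "B = integral {0..1} (\<lambda>t. norm (u t))"
  note cont_p = continuous_on_polynomial_function_cis
  have B: "B \<ge> 0" unfolding B_def by (intro integral_nonneg integrable_continuous_real continuous_intros cont) auto
  have bound: "norm I \<le> e * B" if e: "e > 0" for e
  proof -
    obtain p :: "complex \<Rightarrow> complex" where p: "polynomial_function p" "\<forall>z\<in>sphere 0 1. norm (cnj (G z) - p z) < e"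
      using Stone_Weierstrass_polynomial_function[of "sphere 0 1" "\<lambda>z. cnj (G z)" e] G(1) e
      by (auto intro!: continuous_intros)
    have pr: "real_polynomial_function (\<lambda>z. Re (p z))" "real_polynomial_function (\<lambda>z. Im (p z))"
      using p(1) bounded_linear_Re bounded_linear_Im unfolding polynomial_function_def comp_def by auto
    have "integral {0..1} (\<lambda>t. u t * p (cis (2 * pi * t)))
       = integral {0..1} (\<lambda>t. u t * of_real (Re (p (cis (2 * pi * t)))) * cis (2 * pi * of_int 0 * t)
           + \<i> * (u t * of_real (Im (p (cis (2 * pi * t)))) * cis (2 * pi * of_int 0 * t)))"
      by (intro integral_cong) (simp add: complex_eq_iff)
    also have "\<dots> = 0"
      using fourier_coeffs_zero_mult_polynomial[OF pr(1) cont coeff, of 0] fourier_coeffs_zero_mult_polynomial[OF pr(2) cont coeff, of 0]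
      by (subst integral_add) (auto intro!: integrable_continuous_real continuous_intros cont cont_p[OF p(1)])
    finally have "I = integral {0..1} (\<lambda>t. u t * (cnj (u t) - p (cis (2 * pi * t))))"
      unfolding I_def right_diff_distrib
      by (subst integral_diff) (auto intro!: integrable_continuous_real continuous_intros cont cont_p[OF p(1)])
    also have "norm \<dots> \<le> integral {0..1} (\<lambda>t. e * norm (u t))"
    proof (rule integral_norm_bound_integral)
      fix s :: real assume s: "s \<in> {0..1}"
      have "norm (cnj (u s) - p (cis (2 * pi * s))) \<le> e"
        using p(2)[rule_format, of "cis (2 * pi * s)"] G(2)[OF s] by simp
      then show "norm (u s * (cnj (u s) - p (cis (2 * pi * s)))) \<le> e * norm (u s)"
        using mult_left_mono[of _ e "norm (u s)"] by (simp add: norm_mult mult.commute[of e])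
    qed (auto intro!: integrable_continuous_real continuous_intros cont cont_p[OF p(1)])
    also have "\<dots> = e * B" by (simp add: B_def)
    finally show ?thesis .
  qed
  have "((\<lambda>e. e * B) \<longlongrightarrow> 0 * B) (at_right 0)"
    by (intro tendsto_intros)
  then have "norm I \<le> 0 * B"
    by (rule tendsto_lowerbound) (auto simp: eventually_at_right_less intro: eventually_mono[OF eventually_at_right_less] bound)
  then have I0: "I = 0" by simp
  have "I = integral {0..1} (\<lambda>t. of_real ((norm (u t))\<^sup>2))"
    unfolding I_def by (intro integral_cong) (simp only: complex_norm_square)
  also have "\<dots> = of_real (integral {0..1} (\<lambda>t. (norm (u t))\<^sup>2))"
    by (intro integral_unique has_integral_of_real integrable_integral integrable_continuous_real continuous_intros cont)
  finally have "integral {0..1} (\<lambda>t. (norm (u t))\<^sup>2) = 0" using I0 by (metis of_real_eq_0_iff)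
  then have "(norm (u t))\<^sup>2 = 0"
    using t by (subst (asm) integral_eq_0_iff) (auto intro!: continuous_intros cont)
  then show ?thesis by simp
qed

lemma has_integral_cis:
  fixes m :: int
  shows "((\<lambda>t. cis (2 * pi * m * t)) has_integral (if m = 0 then 1 else 0)) {0..1}"
proof (cases "m = 0")
  case True
  then show ?thesis using has_integral_const_real[of "1::complex" 0 1] by simp
next
  case False
  define F where "F = (\<lambda>t::real. exp (\<i> * of_real (2 * pi * m * t)) / (\<i> * of_real (2 * pi * m)))"
  have "((\<lambda>t. cis (2 * pi * m * t)) has_integral (F 1 - F 0)) {0..1}"
  proof (rule fundamental_theorem_of_calculus)
    fix t :: real
    show "(F has_vector_derivative cis (2 * pi * m * t)) (at t within {0..1})"
      unfolding F_def cis_conv_exp using False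
      by (auto intro!: derivative_eq_intros has_vector_derivative_real_field)
  qed auto
  moreover have "F 1 = F 0"
  proof -
    have "exp (\<i> * of_real (2 * pi * m * 1)) = cis (2 * pi * m)" by (simp add: cis_conv_exp)
    also have "\<dots> = 1" by (intro cis_multiple_2pi) auto
    finally show ?thesis by (simp add: F_def)
  qed
  ultimately show ?thesis using False by simp
qed

text \<open>Absolute summability makes the series converge uniformly to a continuous function with
  the prescribed coefficients. It has the same coefficients as g, so uniqueness identifies the two
  and no pointwise convergence theorem is required.\<close>

lemma fourier_series_has_sum:
  fixes c :: "int \<Rightarrow> complex" and g :: "real \<Rightarrow> complex"
  assumes cont: "continuous_on {0..1} g" and per: "g 0 = g 1"
    and c: "(\<lambda>n. norm (c n)) summable_on UNIV"
    and coeff: "\<And>n. integral {0..1} (\<lambda>t. g t * cis (2 * pi * (- of_int n) * t)) = c n"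
    and t: "t \<in> {0..1}"
  shows "((\<lambda>n. c n * cis (2 * pi * n * t)) has_sum g t) UNIV"
proof -
  \<comment> \<open>\<open>int_decode\<close> lists the integers as a sequence, so that the M-test
    and uniform limits apply; absolute convergence makes the order irrelevant at the end.\<close>
  define h where "h = (\<lambda>t::real. \<Sum>j. c (int_decode j) * cis (2 * pi * int_decode j * t))"
  have sc: "summable (\<lambda>j. norm (c (int_decode j)))"
    using c summable_on_reindex_bij_betw[OF bij_int_decode, of "\<lambda>n. norm (c n)"]
    by (intro summable_on_imp_summable) simp
  have unif: "uniform_limit {0..1} (\<lambda>N t. \<Sum>j<N. c (int_decode j) * cis (2 * pi * int_decode j * t) * cis (2 * pi * n * t))
      (\<lambda>t. \<Sum>j. c (int_decode j) * cis (2 * pi * int_decode j * t) * cis (2 * pi * n * t)) sequentially" for n :: int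
    by (rule Weierstrass_m_test[OF _ sc]) (simp add: norm_mult)
  have sh: "summable (\<lambda>j. c (int_decode j) * cis (2 * pi * int_decode j * t))" for t
    by (rule summable_norm_cancel) (use sc in \<open>simp add: norm_mult\<close>)
  have h: "(\<Sum>j. c (int_decode j) * cis (2 * pi * int_decode j * t) * cis (2 * pi * n * t))
      = h t * cis (2 * pi * n * t)" for t and n :: int
    unfolding h_def using suminf_mult2[OF sh] by simp
  have conth: "continuous_on {0..1} h"
  proof -
    have "continuous_on {0..1} (\<lambda>t. h t * cis (2 * pi * (of_int 0) * t))"
      by (rule uniform_limit_theorem[OF always_eventually[OF allI] unif[of 0, unfolded h]])
         (auto intro!: continuous_intros)
    then show ?thesis by simp
  qed
  have perh: "h 0 = h 1"
    unfolding h_def by (simp add: cis_multiple_2pi)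
  have inth: "integral {0..1} (\<lambda>t. h t * cis (2 * pi * n * t)) = c (- n)" for n :: int
  proof -
    obtain I J where IJ: "\<And>N. ((\<lambda>t. \<Sum>j<N. c (int_decode j) * cis (2 * pi * int_decode j * t) * cis (2 * pi * n * t)) has_integral I N) {0..1}"
        "((\<lambda>t. h t * cis (2 * pi * n * t)) has_integral J) {0..1}" "I \<longlonglongrightarrow> J"
      by (rule uniform_limit_integral[OF unif[of n, unfolded h] _ sequentially_bot])
         (intro continuous_intros, blast)
    have "((\<lambda>t. \<Sum>j<N. c (int_decode j) * (cis (2 * pi * int_decode j * t) * cis (2 * pi * n * t))) has_integral
           (\<Sum>j<N. c (int_decode j) * (if int_decode j + n = 0 then 1 else 0))) {0..1}" for N
      unfolding cis_mult
    proof (intro has_integral_sum has_integral_mult_right)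
      fix j
      show "((\<lambda>t. cis (2 * pi * int_decode j * t + 2 * pi * n * t)) has_integral (if int_decode j + n = 0 then 1 else 0)) {0..1}"
        using has_integral_cis[of "int_decode j + n"] by (simp add: algebra_simps)
    qed auto
    then have "I N = (\<Sum>j<N. c (int_decode j) * (if int_decode j + n = 0 then 1 else 0))" for N
      using IJ(1)[of N] by (simp only: mult.assoc has_integral_unique)
    moreover have "(\<lambda>j. c (int_decode j) * (if int_decode j + n = 0 then 1 else 0)) sums c (- n)"
    proof -
      have "(\<lambda>j. c (int_decode j) * (if int_decode j + n = 0 then 1 else 0))
          = (\<lambda>j. if j = int_encode (- n) then c (int_decode j) else 0)"
        by (auto simp: fun_eq_iff add_eq_0_iff2) (metis int_decode_inverse)
      then show ?thesis using sums_single[of "int_encode (- n)" "\<lambda>j. c (int_decode j)"] by simp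
    qed
    ultimately have "I \<longlonglongrightarrow> c (- n)" unfolding sums_def by presburger
    then have "J = c (- n)" using IJ(3) LIMSEQ_unique by blast
    then show ?thesis using IJ(2) by (simp add: integral_unique)
  qed
  have "g t - h t = 0"
  proof (rule fourier_uniqueness[OF _ _ _ t])
    fix n :: int
    show "integral {0..1} (\<lambda>t. (g t - h t) * cis (2 * pi * n * t)) = 0"
      unfolding left_diff_distrib
      using coeff[of "- n"] inth[of n]
      by (subst integral_diff) (auto intro!: integrable_continuous_real continuous_intros cont conth)
  qed (auto intro!: continuous_intros cont conth simp: per perh)
  moreover have "((\<lambda>j. c (int_decode j) * cis (2 * pi * int_decode j * t)) has_sum h t) UNIV"
    unfolding h_def by (rule norm_summable_imp_has_sum) (use sc summable_sums[OF sh] in \<open>simp_all add: norm_mult\<close>)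
  then have "((\<lambda>n. c n * cis (2 * pi * n * t)) has_sum h t) UNIV"
    using has_sum_reindex_bij_betw[OF bij_int_decode, of "\<lambda>n. c n * cis (2 * pi * n * t)"] by simp
  ultimately show ?thesis by simp
qed

section \<open>Powers times exponentials: decay, integrals and sums\<close>

lemma exp_minus_le_fact_div_power:
  fixes x :: real
  assumes "x > 0"
  shows "exp (- x) \<le> fact p / x ^ p"
proof -
  \<comment> \<open>All terms of the exponential series are positive, so a single one is a lower
    bound. The free p is chosen at each use to leave enough decay.\<close>
  have "x ^ p /\<^sub>R fact p \<le> exp x"
    using sum_le_suminf[OF sums_summable[OF exp_converges[of x]], of "{p}"] sums_unique[OF exp_converges[of x]] assms by simp
  then show ?thesis using assms by (simp add: exp_minus field_simps)
qed

text \<open>This encodes that the integral of u^k exp (-u z) over the half-line is k! / z^(k+1). The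
  limit is taken along the naturals because the half-line will be assembled from unit
  intervals.\<close>

lemma power_exp_antiderivative:
  fixes z :: complex
  assumes "Re z > 0"
  obtains F :: "real \<Rightarrow> complex" where
    "\<And>u. (F has_vector_derivative of_real u ^ k * exp (- (of_real u * z))) (at u)"
    "F 0 = - (fact k / z ^ (k + 1))" "(\<lambda>n. F (real n)) \<longlonglongrightarrow> 0"
proof (induction k arbitrary: thesis)
  case 0
  have z: "z \<noteq> 0" using assms by auto
  have "(\<lambda>n. exp (- z) ^ n) \<longlonglongrightarrow> 0"
    using assms by (intro LIMSEQ_power_zero) (simp add: norm_exp_eq_Re)
  then have "(\<lambda>n. - (exp (- z) ^ n / z)) \<longlonglongrightarrow> - (0 / z)"
    by (intro tendsto_minus tendsto_divide tendsto_const z)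
  moreover have "exp (- (of_real (real n) * z)) = exp (- z) ^ n" for n
    by (simp add: exp_of_nat_mult[symmetric])
  ultimately have lim: "(\<lambda>n. - (exp (- (of_real (real n) * z)) / z)) \<longlonglongrightarrow> 0"
    by (simp only: div_0 minus_zero)
  show ?case using z
    by (intro "0.prems"[OF _ _ lim]) (auto intro!: derivative_eq_intros has_vector_derivative_real_field)
next
  case (Suc k)
  have z: "z \<noteq> 0" using assms by auto
  obtain F :: "real \<Rightarrow> complex" where F:
    "\<And>u. (F has_vector_derivative of_real u ^ k * exp (- (of_real u * z))) (at u)"
    "F 0 = - (fact k / z ^ (k + 1))" "(\<lambda>n. F (real n)) \<longlonglongrightarrow> 0"
    using Suc.IH by blast
  \<comment> \<open>Integration by parts: the boundary term is u^(k+1) exp (-u z) / z, the rest is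
    (k+1)/z times the previous antiderivative.\<close>
  define H where "H = (\<lambda>u::real. (of_nat (Suc k) * F u - of_real u ^ Suc k * exp (- (of_real u * z))) / z)"
  have lim: "(\<lambda>n. of_real (real n) ^ Suc k * exp (- (of_real (real n) * z))) \<longlonglongrightarrow> 0"
  proof (rule Lim_null_comparison)
    show "eventually (\<lambda>n. norm (of_real (real n) ^ Suc k * exp (- (of_real (real n) * z)))
            \<le> fact (k + 2) / Re z ^ (k + 2) * (1 / real n)) sequentially"
      using eventually_gt_at_top[of 0]
    proof eventually_elim
      case (elim n)
      have "norm (of_real (real n) ^ Suc k * exp (- (of_real (real n) * z))) = real n ^ Suc k * exp (- (real n * Re z))"
        by (simp add: norm_mult norm_power)
      also have "\<dots> \<le> real n ^ Suc k * (fact (k + 2) / (real n * Re z) ^ (k + 2))"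
        using elim assms by (intro mult_left_mono exp_minus_le_fact_div_power) auto
      also have "\<dots> = fact (k + 2) / Re z ^ (k + 2) * (1 / real n)"
        using elim by (simp add: power_mult_distrib)
      finally show ?case .
    qed
    show "(\<lambda>n. fact (k + 2) / Re z ^ (k + 2) * (1 / real n)) \<longlonglongrightarrow> 0"
      by (rule tendsto_mult_right_zero) (rule lim_1_over_n)
  qed
  show ?case
  proof (rule Suc.prems)
    fix u :: real
    have "((\<lambda>u. of_real u ^ Suc k * exp (- (of_real u * z))) has_vector_derivative
       of_nat (Suc k) * (of_real u ^ k * exp (- (of_real u * z))) - z * (of_real u ^ Suc k * exp (- (of_real u * z)))) (at u)"
      by (rule has_vector_derivative_real_field) (auto intro!: derivative_eq_intros simp: algebra_simps simp del: power_Suc)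
    from has_vector_derivative_divide[OF has_vector_derivative_diff[OF has_vector_derivative_mult_right[OF F(1), of "of_nat (Suc k)"] this], of z]
    show "(H has_vector_derivative of_real u ^ Suc k * exp (- (of_real u * z))) (at u)"
      unfolding H_def using z by simp
  next
    show "H 0 = - (fact (Suc k) / z ^ (Suc k + 1))" using z by (simp add: H_def F(2))
    have "(\<lambda>n. H (real n)) \<longlonglongrightarrow> (of_nat (Suc k) * 0 - 0) / z"
      unfolding H_def by (intro tendsto_intros F(3) z lim)
    then show "(\<lambda>n. H (real n)) \<longlonglongrightarrow> 0" by simp
  qed
qed

text \<open>The power has n + 1 and the exponential has n because n <= n + t <= n + 1: one series
  majorizes all \<open>lerch\<close> series uniformly for t in the unit interval.\<close>

lemma summable_power_exp:
  assumes "r > 0"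
  shows "summable (\<lambda>n. real (n + 1) ^ k * exp (- (real n * r)))"
proof (rule summable_comparison_test')
  show "summable (\<lambda>n. exp r * (fact (k + 2) / r ^ (k + 2)) * inverse (real (n + 1) ^ 2))"
    using summable_ignore_initial_segment[OF inverse_power_summable[of 2, where 'a = real], of 1]
    by (intro summable_mult) simp
  fix n :: nat
  have aux: "N ^ k * (A / (N * r) ^ (k + 2)) = A / r ^ (k + 2) * inverse (N ^ 2)" if "N > 0" for A N :: real
    using that assms by (simp add: power_mult_distrib power_add power2_eq_square divide_simps)
  have "real (n + 1) ^ k * exp (- (real n * r)) = exp r * (real (n + 1) ^ k * exp (- (real (n + 1) * r)))"
    by (simp add: exp_add[symmetric] algebra_simps)
  also have "\<dots> \<le> exp r * (real (n + 1) ^ k * (fact (k + 2) / (real (n + 1) * r) ^ (k + 2)))"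
    using assms by (intro mult_left_mono exp_minus_le_fact_div_power) auto
  also have "\<dots> = exp r * (fact (k + 2) / r ^ (k + 2)) * inverse (real (n + 1) ^ 2)"
    using assms aux[of "real (n + 1)"] by simp
  finally show "norm (real (n + 1) ^ k * exp (- (real n * r))) \<le> exp r * (fact (k + 2) / r ^ (k + 2)) * inverse (real (n + 1) ^ 2)"
    by simp
qed

section \<open>Lipschitz's formula\<close>

text \<open>This is exp (-t y) times the Lerch transcendent Phi (exp (-y), -k, t).\<close>

definition lerch :: "nat \<Rightarrow> complex \<Rightarrow> real \<Rightarrow> complex" where
  "lerch k y t = (\<Sum>n. of_real (real n + t) ^ k * exp (- (of_real (real n + t) * y)))"

lemma norm_lerch_term_le:
  assumes "Re y > 0" "t \<in> {0..1}"
  shows "norm (of_real (real n + t) ^ k * exp (- (of_real (real n + t) * y))) \<le> real (n + 1) ^ k * exp (- (real n * Re y))"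
proof -
  have "norm (of_real (real n + t) ^ k * exp (- (of_real (real n + t) * y))) = (real n + t) ^ k * exp (- ((real n + t) * Re y))"
  proof -
    have "norm (of_real x ^ k * exp (- (of_real x * y))) = x ^ k * exp (- (x * Re y))" if "x \<ge> 0" for x
      using that by (simp add: norm_mult norm_power)
    from this[of "real n + t"] show ?thesis using assms by simp
  qed
  also have "\<dots> \<le> real (n + 1) ^ k * exp (- (real n * Re y))"
    using assms by (intro mult_mono power_mono) (auto intro!: mult_right_mono)
  finally show ?thesis .
qed

lemma summable_lerch_term:
  assumes "Re y > 0" "t \<in> {0..1}"
  shows "summable (\<lambda>n. norm (of_real (real n + t) ^ k * exp (- (of_real (real n + t) * y))))"
  by (rule summable_comparison_test'[OF summable_power_exp[OF assms(1), of k]])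
     (use norm_lerch_term_le[OF assms] in simp)

lemma continuous_on_lerch:
  assumes "Re y > 0"
  shows "continuous_on {0..1} (lerch k y)"
  unfolding lerch_def
  by (rule uniform_limit_theorem[OF always_eventually[OF allI] Weierstrass_m_test[OF norm_lerch_term_le[OF assms] summable_power_exp[OF assms]]])
     (auto intro!: continuous_intros)

text \<open>Moving t from 0 to 1 shifts the index by one and loses only the term at n = 0, which is
  0 for k >= 1. For k = 0 the periodic extension would jump.\<close>

lemma lerch_0_eq_1:
  assumes "Re y > 0" "k \<ge> 1"
  shows "lerch k y 0 = lerch k y 1"
proof -
  have "lerch k y 0 = (\<Sum>n. of_real (real (Suc n) + 0) ^ k * exp (- (of_real (real (Suc n) + 0) * y)))
      + of_real (real 0 + 0) ^ k * exp (- (of_real (real 0 + 0) * y))"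
    unfolding lerch_def
    by (subst suminf_split_head[OF summable_norm_cancel[OF summable_lerch_term[OF assms(1)]]]) auto
  then show ?thesis using assms(2) by (simp add: lerch_def add.commute)
qed

text \<open>Unfolding: the character has period 1, so the n-th term integrated over the unit
  interval is the integral of u^k exp (-u z) over [n, n+1] with z = y + 2 pi i m. The sum over n
  telescopes to the half-line.\<close>

lemma integral_lerch_cis:
  fixes m :: int
  assumes y: "Re y > 0"
  shows "integral {0..1} (\<lambda>t. lerch k y t * cis (2 * pi * (- of_int m) * t)) = fact k / (y + 2 * pi * \<i> * m) ^ (k + 1)"
proof -
  define z where "z = y + 2 * pi * \<i> * m"
  have z: "Re z > 0" using y by (simp add: z_def)
  obtain F :: "real \<Rightarrow> complex" where F:
    "\<And>u. (F has_vector_derivative of_real u ^ k * exp (- (of_real u * z))) (at u)"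
    "F 0 = - (fact k / z ^ (k + 1))" "(\<lambda>n. F (real n)) \<longlonglongrightarrow> 0"
    using power_exp_antiderivative[OF z] by blast
  define f where "f = (\<lambda>n t. of_real (real n + t) ^ k * exp (- (of_real (real n + t) * y)) * cis (2 * pi * (- of_int m) * t))"
  have f: "f n t = of_real (real n + t) ^ k * exp (- (of_real (real n + t) * z))" for n t
  proof -
    \<comment> \<open>The extra factor is 1; it replaces t by n + t in the character, so that it
      merges with exp (-(n + t) y).\<close>
    have "cis (2 * pi * (- of_int m) * t) = cis (2 * pi * (- of_int m) * t) * cis (2 * pi * (of_int (- m * int n)))"
      by (subst cis_multiple_2pi) auto
    also have "\<dots> = exp (- (of_real (real n + t) * (2 * pi * \<i> * m)))"
      unfolding cis_conv_exp exp_add[symmetric] by (intro arg_cong[of _ _ exp]) (simp add: algebra_simps)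
    finally show ?thesis unfolding f_def z_def by (simp add: exp_add[symmetric] algebra_simps)
  qed
  have sum: "(\<Sum>n. f n t) = lerch k y t * cis (2 * pi * (- of_int m) * t)" if "t \<in> {0..1}" for t
    unfolding f_def lerch_def
    using suminf_mult2[OF summable_norm_cancel[OF summable_lerch_term[OF y that]]] by simp
  have "uniform_limit {0..1} (\<lambda>N t. \<Sum>n<N. f n t) (\<lambda>t. \<Sum>n. f n t) sequentially"
    by (rule Weierstrass_m_test[OF _ summable_power_exp[OF y]])
       (use norm_lerch_term_le[OF y] in \<open>simp add: f_def norm_mult\<close>)
  then obtain I J where IJ: "\<And>N. ((\<lambda>t. \<Sum>n<N. f n t) has_integral I N) {0..1}"
     "((\<lambda>t. \<Sum>n. f n t) has_integral J) {0..1}" "I \<longlonglongrightarrow> J"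
    by (rule uniform_limit_integral[OF _ _ sequentially_bot])
       (unfold f_def, intro continuous_intros, blast)
  have "(f n has_integral (F (real (Suc n)) - F (real n))) {0..1}" for n
  proof -
    have "(f n has_integral (F (real n + 1) - F (real n + 0))) {0..1}"
    proof (rule fundamental_theorem_of_calculus)
      fix t :: real
      have "((\<lambda>t. F (real n + t)) has_vector_derivative 1 *\<^sub>R f n t) (at t)"
        unfolding f
        by (rule vector_diff_chain_at[of "\<lambda>t. real n + t", unfolded o_def, OF _ F(1)])
           (auto intro!: derivative_eq_intros)
      then show "((\<lambda>t. F (real n + t)) has_vector_derivative f n t) (at t within {0..1})"
        by (simp add: has_vector_derivative_at_within)
    qed auto
    then show ?thesis by (simp add: add.commute)
  qed
  then have "((\<lambda>t. \<Sum>n<N. f n t) has_integral (\<Sum>n<N. F (real (Suc n)) - F (real n))) {0..1}" for N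
    by (intro has_integral_sum) auto
  then have "I N = F (real N) - F 0" for N
    using has_integral_unique[OF IJ(1)[of N]] unfolding sum_lessThan_telescope[of "\<lambda>n. F (real n)"] by simp
  moreover have "(\<lambda>N. F (real N) - F 0) \<longlonglongrightarrow> 0 - F 0" by (intro tendsto_intros F(3))
  ultimately have "I \<longlonglongrightarrow> 0 - F 0" by presburger
  with IJ(3) have "J = fact k / z ^ (k + 1)" using LIMSEQ_unique F(2) by (metis diff_0 minus_minus)
  moreover have "integral {0..1} (\<lambda>t. lerch k y t * cis (2 * pi * (- of_int m) * t)) = integral {0..1} (\<lambda>t. \<Sum>n. f n t)"
    by (intro integral_cong) (simp only: sum)
  ultimately show ?thesis using IJ(2) by (simp add: integral_unique z_def)
qed

text \<open>With -n-1 for the negative half, m + \<theta> runs through n + \<theta> and -(n + 1 -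
  \<theta>) for natural n, the shifts that occur in the theorem.\<close>

lemma int_UNIV_split: "(UNIV :: int set) = range int \<union> range (\<lambda>n. - int n - 1)"
proof -
  have "m \<in> range int \<union> range (\<lambda>n. - int n - 1)" for m :: int
    by (cases m rule: int_cases) auto
  then show ?thesis by blast
qed

lemma has_sum_intI:
  fixes f :: "int \<Rightarrow> 'a::topological_comm_monoid_add"
  assumes "((\<lambda>n. f (int n)) has_sum A) UNIV" "((\<lambda>n. f (- int n - 1)) has_sum B) UNIV"
  shows "(f has_sum (A + B)) UNIV"
  unfolding int_UNIV_split
proof (rule has_sum_Un_disjoint)
  show "(f has_sum A) (range int)"
    using assms(1) by (subst has_sum_reindex) (auto simp: o_def)
  show "(f has_sum B) (range (\<lambda>n. - int n - 1))"
    using assms(2) by (subst has_sum_reindex) (auto simp: o_def inj_on_def)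
qed auto

lemma summable_on_intI:
  fixes f :: "int \<Rightarrow> 'a::topological_comm_monoid_add"
  assumes "(\<lambda>n. f (int n)) summable_on UNIV" "(\<lambda>n. f (- int n - 1)) summable_on UNIV"
  shows "f summable_on UNIV"
  using assms has_sum_intI unfolding summable_on_def by blast

text \<open>As |w| > 1, the modulus of y + w n is at least n once n >= |y| / (|w| - 1). It is
  applied with |w| = 2 pi.\<close>

lemma summable_inverse_linear_power:
  fixes y w a :: complex
  assumes w: "norm w > 1" and k: "k \<ge> 1"
  shows "summable (\<lambda>n. norm (a / (y + w * of_nat n) ^ (k + 1)))"
proof (rule summable_comparison_test_ev)
  show "summable (\<lambda>n. norm a * inverse (real n ^ 2))"
    by (intro summable_mult inverse_power_summable) simp
  have "eventually (\<lambda>n. real n \<ge> norm y / (norm w - 1)) sequentially"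
    using filterlim_at_top filterlim_real_sequentially by blast
  with eventually_gt_at_top[of 0]
  show "eventually (\<lambda>n. norm (norm (a / (y + w * of_nat n) ^ (k + 1))) \<le> norm a * inverse (real n ^ 2)) sequentially"
  proof eventually_elim
    case (elim n)
    have "real n + norm y \<le> norm w * real n" using elim w by (simp add: field_simps)
    also have "\<dots> = norm ((y + w * of_nat n) - y)" by (simp add: norm_mult)
    also have "\<dots> \<le> norm (y + w * of_nat n) + norm y" by (rule norm_triangle_ineq4)
    finally have "real n \<le> norm (y + w * of_nat n)" by simp
    then have "real n ^ (k + 1) \<le> norm (y + w * of_nat n) ^ (k + 1)" by (intro power_mono) auto
    moreover have "real n ^ 2 \<le> real n ^ (k + 1)" using elim k by (intro power_increasing) auto
    ultimately have "real n ^ 2 \<le> norm (y + w * of_nat n) ^ (k + 1)" by linarith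
    moreover have "0 < real n ^ 2" using elim by simp
    ultimately have "norm a / norm (y + w * of_nat n) ^ (k + 1) \<le> norm a / real n ^ 2"
      by (intro frac_le norm_ge_zero order_refl)
    then show ?case by (simp only: real_norm_def abs_norm_cancel) (simp only: norm_divide norm_power, simp only: divide_inverse)
  qed
qed

lemma summable_on_lerch_coeff:
  assumes y: "Re y > 0" and k: "k \<ge> 1"
  shows "(\<lambda>m::int. norm (fact k / (y + 2 * pi * \<i> * m) ^ (k + 1))) summable_on UNIV"
proof (rule summable_on_intI)
  show "(\<lambda>n. norm (fact k / (y + 2 * pi * \<i> * int n) ^ (k + 1))) summable_on UNIV"
    using summable_inverse_linear_power[of "2 * pi * \<i>" k "fact k" y] pi_gt3 k
    by (subst summable_on_UNIV_nonneg_real_iff) (simp_all add: norm_mult)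
  show "(\<lambda>n. norm (fact k / (y + 2 * pi * \<i> * (- int n - 1)) ^ (k + 1))) summable_on UNIV"
    using summable_inverse_linear_power[of "- (2 * pi * \<i>)" k "fact k" "y - 2 * pi * \<i>"] pi_gt3 k
    by (subst summable_on_UNIV_nonneg_real_iff) (simp_all add: norm_mult algebra_simps)
qed

lemma lerch_has_sum:
  assumes "Re y > 0" "k \<ge> 1" "t \<in> {0..1}"
  shows "((\<lambda>m::int. fact k / (y + 2 * pi * \<i> * m) ^ (k + 1) * cis (2 * pi * m * t)) has_sum lerch k y t) UNIV"
  by (rule fourier_series_has_sum[OF continuous_on_lerch lerch_0_eq_1 summable_on_lerch_coeff integral_lerch_cis])
     (use assms in auto)

section \<open>The transformation formula\<close>

lemma has_sum_eqI:
  assumes "(f has_sum S) A" "\<And>x. x \<in> A \<Longrightarrow> f x = g x" "S = T"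
  shows "(g has_sum T) A"
  using assms has_sum_cong by metis

lemma abs_summable_on_Times_bound:
  fixes F :: "'a \<times> 'b \<Rightarrow> 'c::real_normed_vector" and f :: "'a \<Rightarrow> real" and g :: "'b \<Rightarrow> real"
  assumes "f summable_on A" "g summable_on B"
    and "\<And>i. i \<in> A \<Longrightarrow> 0 \<le> f i" "\<And>j. j \<in> B \<Longrightarrow> 0 \<le> g j"
    and "\<And>i j. i \<in> A \<Longrightarrow> j \<in> B \<Longrightarrow> norm (F (i, j)) \<le> f i * g j"
  shows "(\<lambda>x. norm (F x)) summable_on A \<times> B"
proof -
  have "(\<lambda>(i, j). f i * g j) summable_on A \<times> B"
  proof (rule summable_on_SigmaI)
    show "((\<lambda>j. (\<lambda>(i, j). f i * g j) (i, j)) has_sum f i * infsum g B) B" if "i \<in> A" for i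
      using has_sum_cmult_right[OF has_sum_infsum[OF assms(2)]] by simp
    show "(\<lambda>i. f i * infsum g B) summable_on A"
      using assms(1) by (rule summable_on_cmult_left)
  qed (use assms in auto)
  then show ?thesis
    by (rule summable_on_comparison_test) (use assms(5) in auto)
qed

lemma summable_on_shifted_powr:
  assumes "v \<ge> 0" "p > 1"
  shows "(\<lambda>n. (real n + v) powr - p) summable_on UNIV"
proof -
  have "summable (\<lambda>n. (real n + v) powr - p)"
  proof (rule summable_comparison_test_ev)
    show "summable (\<lambda>n. real n powr - p)" using assms by (simp add: summable_real_powr_iff)
    show "eventually (\<lambda>n. norm ((real n + v) powr - p) \<le> real n powr - p) sequentially"
      using eventually_gt_at_top[of 0]
    proof eventually_elim
      case (elim n)
      then show ?case using assms by (auto intro!: powr_mono2')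
    qed
  qed
  then show ?thesis by (subst summable_on_UNIV_nonneg_real_iff) auto
qed

text \<open>The real part is even in \<open>v\<close> and, for even \<open>k\<close>, odd in \<open>w\<close>; it is the meeting point of the two
  applications of Lipschitz's formula.\<close>
definition cauchy_re :: "nat \<Rightarrow> real \<Rightarrow> real \<Rightarrow> real" where
  "cauchy_re k w v = Re (1 / (of_real w + 2 * pi * \<i> * v) ^ (k + 1))"

lemma cauchy_re_minus: "cauchy_re k w (- v) = cauchy_re k w v"
proof -
  have "complex_of_real w + 2 * pi * \<i> * of_real (- v) = cnj (of_real w + 2 * pi * \<i> * v)"
    by (simp add: complex_eq_iff)
  then have "1 / (complex_of_real w + 2 * pi * \<i> * of_real (- v)) ^ (k + 1) = cnj (1 / (of_real w + 2 * pi * \<i> * v) ^ (k + 1))"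
    by simp
  then show ?thesis by (simp only: cauchy_re_def cnj.sel)
qed

text \<open>Take y = w + 2 pi i \<theta> and t = 0 in Lipschitz's formula: the real part of exp (-d
  y) supplies the cosine, and the frequency m is moved to m + \<theta>. Evenness of
  \<open>cauchy_re\<close> in its last argument removes the sign of the negative half.\<close>

lemma has_sum_cos_exp:
  fixes w \<theta> :: real
  assumes w: "w > 0" and k: "k \<ge> 1"
  shows "((\<lambda>n. cauchy_re k w (real n + \<theta>) + cauchy_re k w (real n + 1 - \<theta>)) has_sum
            (\<Sum>\<^sub>\<infinity>d. real d ^ k * cos (2 * pi * real d * \<theta>) * exp (- (real d * w))) / fact k) UNIV"
proof -
  define y where "y = of_real w + 2 * pi * \<i> * \<theta>"
  define f where "f = (\<lambda>m::int. fact k / (y + 2 * pi * \<i> * m) ^ (k + 1))"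
  have y: "Re y > 0" using w by (simp add: y_def)
  have f: "(f has_sum lerch k y 0) UNIV"
    using lerch_has_sum[OF y k, of 0] by (simp add: f_def)
  then have "f summable_on UNIV" by (rule has_sum_imp_summable)
  then have fs: "f summable_on range int" "f summable_on range (\<lambda>n. - int n - 1)"
    by (rule summable_on_subset_banach; simp)+
  have "(\<lambda>n. f (int n)) summable_on UNIV" "(\<lambda>n. f (- int n - 1)) summable_on UNIV"
    using fs[THEN summable_on_reindex[THEN iffD1, rotated]] by (auto simp: o_def inj_on_def)
  then obtain S T where ST: "((\<lambda>n. f (int n)) has_sum S) UNIV" "((\<lambda>n. f (- int n - 1)) has_sum T) UNIV"
    unfolding summable_on_def by blast
  have "S + T = lerch k y 0" using has_sum_intI[OF ST] f has_sum_unique by blast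
  with has_sum_add[OF ST] have "((\<lambda>n. f (int n) + f (- int n - 1)) has_sum lerch k y 0) UNIV" by simp
  from has_sum_divide_const[OF has_sum_Re[OF this], of "fact k"]
  have 1: "((\<lambda>n. Re (f (int n) + f (- int n - 1)) / fact k) has_sum Re (lerch k y 0) / fact k) UNIV" .
  have re: "Re (of_real r * z) = r * Re z" for r z
    by simp
  have 2: "Re (f (int n) + f (- int n - 1)) / fact k = cauchy_re k w (real n + \<theta>) + cauchy_re k w (real n + 1 - \<theta>)" for n
  proof -
    have "f (int n) = of_real (fact k) * (1 / (of_real w + 2 * pi * \<i> * (real n + \<theta>)) ^ (k + 1))"
      by (simp add: f_def y_def algebra_simps)
    moreover have "f (- int n - 1) = of_real (fact k) * (1 / (of_real w + 2 * pi * \<i> * (- (real n + 1 - \<theta>))) ^ (k + 1))"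
      by (simp add: f_def y_def algebra_simps)
    ultimately have "Re (f (int n) + f (- int n - 1)) = fact k * (cauchy_re k w (real n + \<theta>) + cauchy_re k w (- (real n + 1 - \<theta>)))"
      unfolding cauchy_re_def by (simp only: re plus_complex.sel distrib_left of_real_add of_real_diff of_real_minus of_real_1)
    then show ?thesis unfolding cauchy_re_minus by simp
  qed
  have "(\<lambda>n. of_real (real n + 0) ^ k * exp (- (of_real (real n + 0) * y))) sums lerch k y 0"
    unfolding lerch_def by (intro summable_sums summable_norm_cancel[OF summable_lerch_term] y) auto
  then have "((\<lambda>n. of_real (real n + 0) ^ k * exp (- (of_real (real n + 0) * y))) has_sum lerch k y 0) UNIV"
    by (intro norm_summable_imp_has_sum summable_lerch_term y) auto
  from has_sum_Re[OF this]
  have "((\<lambda>n. real n ^ k * cos (2 * pi * real n * \<theta>) * exp (- (real n * w))) has_sum Re (lerch k y 0)) UNIV"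
  proof (rule has_sum_eqI)
    fix n :: nat
    have "exp (- (of_real (real n + 0) * y)) = of_real (exp (- (real n * w))) * cis (- (2 * pi * real n * \<theta>))"
      unfolding cis_conv_exp exp_of_real[symmetric] exp_add[symmetric]
      by (intro arg_cong[of _ _ exp]) (simp add: y_def algebra_simps)
    then have "of_real (real n + 0) ^ k * exp (- (of_real (real n + 0) * y))
        = of_real (real n ^ k * exp (- (real n * w))) * cis (- (2 * pi * real n * \<theta>))"
      by simp
    then show "Re (of_real (real n + 0) ^ k * exp (- (of_real (real n + 0) * y)))
        = real n ^ k * cos (2 * pi * real n * \<theta>) * exp (- (real n * w))"
      by (simp only: re cis.sel cos_minus, simp only: mult_ac)
  qed simp
  then show ?thesis using 1 unfolding 2 by (simp add: infsumI)
qed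

text \<open>By evenness the value at -n-1 is the value at n+1, so the negative half is the
  nonnegative half without its zero term. Because f vanishes at 0 the two halves have equal
  sums.\<close>

lemma has_sum_even_int:
  fixes f :: "int \<Rightarrow> real"
  assumes f: "(f has_sum S) UNIV" and even: "\<And>m. f (- m) = f m" and f0: "f 0 = 0"
  shows "((\<lambda>n. 2 * f (int n)) has_sum S) UNIV"
proof -
  have "f summable_on range int"
    by (rule summable_on_subset_banach[OF has_sum_imp_summable[OF f]]) simp
  then have "(\<lambda>n. f (int n)) summable_on UNIV"
    by (subst (asm) summable_on_reindex) (auto simp: o_def)
  then obtain A where A: "((\<lambda>n. f (int n)) has_sum A) UNIV"
    unfolding summable_on_def by blast
  have eq: "f (- int n - 1) = f (int (Suc n))" for n
  proof -
    have "- int n - 1 = - int (Suc n)" by simp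
    then show ?thesis by (simp only: even)
  qed
  from A have "((\<lambda>n. f (int n)) has_sum A) (range Suc)"
  proof (rule has_sum_cong_neutral[THEN iffD1, rotated -1])
    fix n assume "n \<in> UNIV - range Suc"
    then have "n = 0" by (cases n) auto
    then show "f (int n) = 0" by (simp add: f0)
  qed auto
  then have "((\<lambda>n. f (- int n - 1)) has_sum A) UNIV"
    unfolding eq by (subst (asm) has_sum_reindex) (auto simp: o_def)
  from has_sum_intI[OF A this] f have "S = 2 * A" using has_sum_unique by fastforce
  then show ?thesis using has_sum_cmult_right[OF A, of 2] by simp
qed

text \<open>Factoring out 2 pi i / s gives 4 pi^2 v / s + 2 pi i n = (2 pi i / s) (n s - 2 pi i v),
  which swaps the roles of n and v. For even k the power i^(k+1) is (-1)^(k/2) i, turning the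
  imaginary part into a real part.\<close>

lemma Im_inverse_power_eq_cauchy_re:
  assumes "s > 0" "even k"
  shows "Im (1 / (of_real (4 * pi\<^sup>2 * v / s) + 2 * pi * \<i> * of_real n) ^ (k + 1))
     = - ((s / (2 * pi)) ^ (k + 1) * (- 1) ^ (k div 2) * cauchy_re k (n * s) v)"
proof -
  define Z where "Z = 1 / (of_real (n * s) + 2 * pi * \<i> * of_real (- v)) ^ (k + 1)"
  have 1: "of_real (4 * pi\<^sup>2 * v / s) + 2 * pi * \<i> * of_real n
      = of_real (2 * pi / s) * \<i> * (of_real (n * s) + 2 * pi * \<i> * of_real (- v))"
    using assms(1) by (simp add: complex_eq_iff power2_eq_square field_simps)
  have 2: "\<i> ^ (k + 1) = of_real ((- 1) ^ (k div 2)) * \<i>"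
    using assms(2) by (auto elim!: evenE simp: power_mult)
  have "1 / (of_real (4 * pi\<^sup>2 * v / s) + 2 * pi * \<i> * of_real n) ^ (k + 1)
     = of_real ((s / (2 * pi)) ^ (k + 1)) * (1 / \<i> ^ (k + 1)) * Z"
    unfolding 1 power_mult_distrib Z_def by (simp add: power_divide)
  also have "1 / \<i> ^ (k + 1) = of_real ((- 1) ^ (k div 2)) * (- \<i>)"
    unfolding 2 by (cases "even (k div 2)") auto
  finally have "Im (1 / (of_real (4 * pi\<^sup>2 * v / s) + 2 * pi * \<i> * of_real n) ^ (k + 1))
      = - ((s / (2 * pi)) ^ (k + 1) * (- 1) ^ (k div 2) * Re Z)"
    by (simp only: mult.assoc[symmetric] of_real_mult[symmetric]) (simp add: mult.assoc)
  then show ?thesis using cauchy_re_minus[of k "n * s" v] by (simp only: cauchy_re_def Z_def)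
qed

text \<open>For positive y both values are real, and \<open>Re\<close> only changes the type. Under
  \<psi> -> 1 - \<psi> each character is conjugated, so the difference retains exactly the sine part
  of the Fourier series.\<close>

definition odd_lerch :: "nat \<Rightarrow> real \<Rightarrow> real \<Rightarrow> real" where
  "odd_lerch k \<psi> y = Re (lerch k (of_real y) \<psi> - lerch k (of_real y) (1 - \<psi>))"

lemma has_sum_odd_lerch:
  assumes "y > 0" "0 < \<psi>" "\<psi> < 1"
  shows "((\<lambda>n. (real n + \<psi>) ^ k * exp (- ((real n + \<psi>) * y)) - (real n + 1 - \<psi>) ^ k * exp (- ((real n + 1 - \<psi>) * y)))
      has_sum odd_lerch k \<psi> y) UNIV"
proof -
  have *: "((\<lambda>n. (real n + t) ^ k * exp (- ((real n + t) * y))) has_sum Re (lerch k (of_real y) t)) UNIV"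
    if "t \<in> {0..1}" for t
  proof -
    have "((\<lambda>n. of_real (real n + t) ^ k * exp (- (of_real (real n + t) * of_real y))) has_sum lerch k (of_real y) t) UNIV"
      unfolding lerch_def
      by (intro norm_summable_imp_has_sum summable_sums[OF summable_norm_cancel] summable_lerch_term) (use assms that in auto)
    from has_sum_Re[OF this] show ?thesis
      unfolding of_real_mult[symmetric] of_real_minus[symmetric] exp_of_real of_real_power[symmetric] by simp
  qed
  have "((\<lambda>n. (real n + \<psi>) ^ k * exp (- ((real n + \<psi>) * y)) + - ((real n + (1 - \<psi>)) ^ k * exp (- ((real n + (1 - \<psi>)) * y))))
      has_sum (Re (lerch k (of_real y) \<psi>) + - Re (lerch k (of_real y) (1 - \<psi>)))) UNIV"
    by (intro has_sum_add has_sum_uminusI *) (use assms in auto)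
  then show ?thesis by (simp add: odd_lerch_def add_diff_eq)
qed

text \<open>Lipschitz's formula read from right to left at y = 4 pi^2 v / s. In the 4 one factor 2
  comes from cis - cnj cis = 2 i sin, the other from folding the integers onto the naturals; sine
  and the imaginary part are both odd in m, so their product is even.\<close>

lemma has_sum_sin_cauchy_re:
  assumes s: "s > 0" and v: "v > 0" and k: "even k" "k \<ge> 1" and \<psi>: "0 < \<psi>" "\<psi> < 1"
  shows "((\<lambda>n. sin (2 * pi * real n * \<psi>) * cauchy_re k (real n * s) v) has_sum
     (- 1) ^ (k div 2) * (2 * pi / s) ^ (k + 1) / (4 * fact k) * odd_lerch k \<psi> (4 * pi\<^sup>2 * v / s)) UNIV"
proof -
  define y where "y = 4 * pi\<^sup>2 * v / s"
  have y: "y > 0" using s v by (simp add: y_def)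
  define f where "f = (\<lambda>m::int. 1 / (of_real y + 2 * pi * \<i> * of_real (real_of_int m)) ^ (k + 1))"
  define g where "g = (\<lambda>m::int. - 2 * fact k * (sin (2 * pi * m * \<psi>) * Im (f m)))"
  have L: "((\<lambda>m::int. fact k * f m * cis (2 * pi * m * t)) has_sum lerch k (of_real y) t) UNIV" if "t \<in> {0..1}" for t
    using lerch_has_sum[of "of_real y" k t] y k that by (simp add: f_def)
  have "((\<lambda>m::int. fact k * f m * cis (2 * pi * m * \<psi>) + - (fact k * f m * cis (2 * pi * m * (1 - \<psi>)))) has_sum
      (lerch k (of_real y) \<psi> + - lerch k (of_real y) (1 - \<psi>))) UNIV"
    by (intro has_sum_add has_sum_uminusI L) (use \<psi> in auto)
  from has_sum_Re[OF this]
  have "(g has_sum odd_lerch k \<psi> y) UNIV"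
  proof (rule has_sum_eqI)
    show "Re (lerch k (of_real y) \<psi> + - lerch k (of_real y) (1 - \<psi>)) = odd_lerch k \<psi> y" by (simp add: odd_lerch_def)
    fix m :: int
    have "cis (2 * pi * m * (1 - \<psi>)) = cis (2 * pi * m) * cis (- (2 * pi * m * \<psi>))"
      by (simp add: cis_mult algebra_simps)
    also have "cis (2 * pi * m) = 1" by (rule cis_multiple_2pi) auto
    finally have "cis (2 * pi * m * (1 - \<psi>)) = cis (- (2 * pi * m * \<psi>))" by simp
    then have "fact k * f m * cis (2 * pi * m * \<psi>) + - (fact k * f m * cis (2 * pi * m * (1 - \<psi>)))
       = of_real (fact k) * (f m * (cis (2 * pi * m * \<psi>) - cis (- (2 * pi * m * \<psi>))))"
      by (simp add: algebra_simps)
    also have "cis (2 * pi * m * \<psi>) - cis (- (2 * pi * m * \<psi>)) = of_real (2 * sin (2 * pi * m * \<psi>)) * \<i>"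
      by (simp add: complex_eq_iff)
    finally show "Re (fact k * f m * cis (2 * pi * m * \<psi>) + - (fact k * f m * cis (2 * pi * m * (1 - \<psi>)))) = g m"
      by (simp add: g_def)
  qed
  then have "((\<lambda>n. 2 * g (int n)) has_sum odd_lerch k \<psi> y) UNIV"
  proof (rule has_sum_even_int)
    fix m :: int
    have "of_real y + 2 * pi * \<i> * of_real (real_of_int (- m)) = cnj (of_real y + 2 * pi * \<i> * of_real (real_of_int m))"
      by (simp add: complex_eq_iff)
    then have "f (- m) = cnj (f m)" unfolding f_def by simp
    then show "g (- m) = g m" by (simp add: g_def)
  qed (simp add: g_def)
  moreover have "2 * g (int n) = 4 * fact k * (s / (2 * pi)) ^ (k + 1) * (- 1) ^ (k div 2) * (sin (2 * pi * real n * \<psi>) * cauchy_re k (real n * s) v)" for n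
    using Im_inverse_power_eq_cauchy_re[OF s k(1), of v "real n"] unfolding g_def f_def y_def of_int_of_nat_eq by simp
  ultimately have "((\<lambda>n. 4 * fact k * (s / (2 * pi)) ^ (k + 1) * (- 1) ^ (k div 2) * (sin (2 * pi * real n * \<psi>) * cauchy_re k (real n * s) v)) has_sum odd_lerch k \<psi> y) UNIV"
    by simp
  then have "((\<lambda>n. sin (2 * pi * real n * \<psi>) * cauchy_re k (real n * s) v) has_sum
      odd_lerch k \<psi> y / (4 * fact k * (s / (2 * pi)) ^ (k + 1) * (- 1) ^ (k div 2))) UNIV"
    using s by (subst (asm) has_sum_cmult_right_iff) auto
  moreover have "odd_lerch k \<psi> y / (4 * fact k * (s / (2 * pi)) ^ (k + 1) * (- 1) ^ (k div 2))
     = (- 1) ^ (k div 2) * (2 * pi / s) ^ (k + 1) / (4 * fact k) * odd_lerch k \<psi> y"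
    by (cases "even (k div 2)") (simp_all add: power_divide mult_ac del: power_Suc)
  ultimately show ?thesis by (simp only: y_def)
qed

section \<open>Majorants for the double series\<close>

lemma abs_cauchy_re_le:
  fixes k :: nat
  assumes "w > 0" "v > 0"
  defines "q \<equiv> real (k + 1) / 2"
  shows "\<bar>cauchy_re k w v\<bar> \<le> (4 * pi) powr - q * (w powr - q * v powr - q)"
proof -
  define z where "z = complex_of_real w + 2 * pi * \<i> * v"
  \<comment> \<open>The inequality of the arithmetic and geometric mean divides the decay of 1 /
    |z|^(k+1) equally between w and v, whence the exponent q = (k+1)/2 for both.\<close>
  have "4 * pi * (w * v) \<le> w\<^sup>2 + (2 * pi * v)\<^sup>2"
    using sum_squares_bound[of w "2 * pi * v"] by (simp add: mult_ac)
  also have "\<dots> = (norm z)\<^sup>2" by (simp add: z_def cmod_power2)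
  finally have z2: "4 * pi * (w * v) \<le> (norm z)\<^sup>2" .
  have z0: "norm z > 0" using assms by (auto simp: z_def complex_eq_iff)
  have "\<bar>cauchy_re k w v\<bar> \<le> norm (1 / z ^ (k + 1))"
    unfolding cauchy_re_def z_def by (rule abs_Re_le_cmod)
  also have "\<dots> = 1 / norm z ^ (k + 1)"
    by (simp only: norm_divide norm_power norm_one)
  also have "\<dots> = norm z powr - real (k + 1)"
    using z0 by (simp only: powr_minus powr_realpow divide_inverse mult_1)
  also have "\<dots> = norm z powr (2 * - q)"
    by (rule arg_cong[of _ _ "\<lambda>r. norm z powr r"]) (simp add: q_def field_simps)
  also have "\<dots> = ((norm z)\<^sup>2) powr - q"
    using z0 by (simp only: powr_powr[symmetric] powr_numeral)
  also have "\<dots> \<le> (4 * pi * (w * v)) powr - q"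
    using assms z2 by (intro powr_mono2') (auto simp: q_def)
  also have "\<dots> = (4 * pi) powr - q * (w powr - q * v powr - q)"
    using assms by (simp add: powr_mult)
  finally show ?thesis .
qed

text \<open>The exponent p = k + 2 absorbs the growth w^k and leaves w^(-2), while v receives the
  full power k + 2; both are summable.\<close>

lemma exp_minus_le_powr:
  assumes "c > 0" "w > 0" "v > 0"
  shows "w ^ k * exp (- (c * (w * v))) \<le> fact (k + 2) / c ^ (k + 2) * (w powr - 2 * v powr - real (k + 2))"
proof -
  have "w ^ k * exp (- (c * (w * v))) \<le> w ^ k * (fact (k + 2) / (c * (w * v)) ^ (k + 2))"
    using assms by (intro mult_left_mono exp_minus_le_fact_div_power) auto
  also have "\<dots> = fact (k + 2) / c ^ (k + 2) * (inverse (w ^ 2) * inverse (v ^ (k + 2)))"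
    using assms by (simp add: power_mult_distrib power_add power2_eq_square divide_simps del: fact_Suc)
  also have "\<dots> = fact (k + 2) / c ^ (k + 2) * (w powr - 2 * v powr - real (k + 2))"
    using assms by (simp only: powr_minus powr_realpow powr_numeral)
  finally show ?thesis .
qed

text \<open>As j runs through the integers, |j + \<psi>| takes the values n + \<psi> and n + 1 -
  \<psi>, weighted here by the sign of j + \<psi>; the lattice of \<theta> is treated likewise
  without sign. The codomain is a type variable because H is a real exponential in the
  transformation formula and complex in the integration.\<close>

definition theta_kernel :: "(real \<Rightarrow> real \<Rightarrow> 'a::real_vector) \<Rightarrow> real \<Rightarrow> real \<Rightarrow> nat \<times> nat \<Rightarrow> 'a" where
  "theta_kernel H \<theta> \<psi> = (\<lambda>(m, n). H (real n + \<psi>) (real m + \<theta>) - H (real n + 1 - \<psi>) (real m + \<theta>)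
        - H (real n + 1 - \<psi>) (real m + 1 - \<theta>) + H (real n + \<psi>) (real m + 1 - \<theta>))"

definition theta_majorant :: "(real \<Rightarrow> real \<Rightarrow> real) \<Rightarrow> real \<Rightarrow> real \<Rightarrow> nat \<times> nat \<Rightarrow> real" where
  "theta_majorant G \<theta> \<psi> = (\<lambda>(m, n). G (real n + \<psi>) (real m + \<theta>) + G (real n + 1 - \<psi>) (real m + \<theta>)
        + G (real n + 1 - \<psi>) (real m + 1 - \<theta>) + G (real n + \<psi>) (real m + 1 - \<theta>))"

lemma norm_theta_kernel_le:
  fixes H :: "real \<Rightarrow> real \<Rightarrow> 'a::real_normed_vector"
  shows "norm (theta_kernel H \<theta> \<psi> x) \<le> theta_majorant (\<lambda>u v. norm (H u v)) \<theta> \<psi> x"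
  unfolding theta_kernel_def theta_majorant_def
  by (cases x) (auto intro!: norm_triangle_le norm_triangle_le_diff add_mono)

lemma summable_theta_majorant:
  assumes "0 < \<theta>" "\<theta> < 1" "0 < \<psi>" "\<psi> < 1" "p > 1" "q > 1"
    and G: "\<And>u v. u > 0 \<Longrightarrow> v > 0 \<Longrightarrow> 0 \<le> G u v"
           "\<And>u v. u > 0 \<Longrightarrow> v > 0 \<Longrightarrow> G u v \<le> C * (u powr - p * v powr - q)"
  shows "theta_majorant G \<theta> \<psi> summable_on UNIV"
proof -
  have C: "C \<ge> 0" using G[of 1 1] by simp
  have *: "(\<lambda>x. norm (G (real (snd x) + t) (real (fst x) + r))) summable_on UNIV \<times> UNIV" if "t > 0" "r > 0" for t r
  proof (rule abs_summable_on_Times_bound)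
    show "(\<lambda>m. C * (real m + r) powr - q) summable_on UNIV"
      using assms that by (intro summable_on_cmult_right summable_on_shifted_powr) auto
    show "(\<lambda>n. (real n + t) powr - p) summable_on UNIV"
      using assms that by (intro summable_on_shifted_powr) auto
    fix m n :: nat
    show "norm (G (real (snd (m, n)) + t) (real (fst (m, n)) + r)) \<le> C * (real m + r) powr - q * (real n + t) powr - p"
      using G[of "real n + t" "real m + r"] that by (simp add: mult_ac)
  qed (use C in auto)
  have **: "(\<lambda>(m, n). G (real n + t) (real m + r)) summable_on UNIV" if "t > 0" "r > 0" for t r
    using *[OF that] unfolding UNIV_Times_UNIV
    by (rule summable_on_cong[THEN iffD1, rotated]) (use G(1) that in auto)
  have "(\<lambda>x. (case x of (m, n) \<Rightarrow> G (real n + \<psi>) (real m + \<theta>)) + (case x of (m, n) \<Rightarrow> G (real n + (1 - \<psi>)) (real m + \<theta>))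
        + (case x of (m, n) \<Rightarrow> G (real n + (1 - \<psi>)) (real m + (1 - \<theta>))) + (case x of (m, n) \<Rightarrow> G (real n + \<psi>) (real m + (1 - \<theta>))))
        summable_on UNIV"
    using assms(1-4) by (intro summable_on_add **) auto
  then show ?thesis
    by (rule summable_on_cong[THEN iffD1, rotated]) (auto simp: theta_majorant_def add_diff_eq)
qed

lemma abs_summable_cos_sin_exp:
  assumes s: "s > 0" and k: "k \<ge> 1"
  shows "(\<lambda>x. norm (case x of (d, e) \<Rightarrow> real d ^ k * cos (2 * pi * real d * \<theta>) * sin (2 * pi * real e * \<psi>) * exp (- (s * (real d * real e))))) summable_on UNIV"
  unfolding UNIV_Times_UNIV[symmetric]
proof (rule abs_summable_on_Times_bound)
  define C where "C = fact (k + 2) / s ^ (k + 2)"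
  have C: "C \<ge> 0" using s by (simp add: C_def del: fact_Suc)
  show "(\<lambda>d. C * (real d + 0) powr - 2) summable_on UNIV"
    by (intro summable_on_cmult_right summable_on_shifted_powr) auto
  show "(\<lambda>e. (real e + 0) powr - real (k + 2)) summable_on UNIV"
    by (intro summable_on_shifted_powr) auto
  show "0 \<le> C * (real d + 0) powr - 2" for d using C by auto
  fix d e :: nat
  show "norm (case (d, e) of (d, e) \<Rightarrow> real d ^ k * cos (2 * pi * real d * \<theta>) * sin (2 * pi * real e * \<psi>) * exp (- (s * (real d * real e))))
     \<le> C * (real d + 0) powr - 2 * (real e + 0) powr - real (k + 2)"
  proof (cases "d = 0 \<or> e = 0")
    \<comment> \<open>The bound is 0 here, since \<open>0 powr _\<close> is 0. The term must vanish
      too: d = 0 is killed by the power k >= 1, e = 0 by the sine.\<close>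
    case True
    then show ?thesis using k C by auto
  next
    case False
    have "\<bar>cos (2 * pi * real d * \<theta>)\<bar> * \<bar>sin (2 * pi * real e * \<psi>)\<bar> \<le> 1"
      by (intro mult_le_one) auto
    then have "(\<bar>cos (2 * pi * real d * \<theta>)\<bar> * \<bar>sin (2 * pi * real e * \<psi>)\<bar>) * (real d ^ k * exp (- (s * (real d * real e))))
       \<le> 1 * (real d ^ k * exp (- (s * (real d * real e))))"
      by (intro mult_right_mono) auto
    also have "\<dots> \<le> C * (real d powr - 2 * real e powr - real (k + 2))"
      unfolding C_def mult_1 using s False by (intro exp_minus_le_powr) auto
    finally show ?thesis by (simp add: abs_mult mult_ac)
  qed
qed simp

lemma summable_theta_kernel_exp:
  assumes "c > 0" "0 < \<theta>" "\<theta> < 1" "0 < \<psi>" "\<psi> < 1"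
  shows "theta_kernel (\<lambda>u v. u ^ k * exp (- (c * (u * v)))) \<theta> \<psi> summable_on UNIV"
proof (rule abs_summable_summable, rule summable_on_comparison_test)
  show "theta_majorant (\<lambda>u v. norm (u ^ k * exp (- (c * (u * v))))) \<theta> \<psi> summable_on UNIV"
  proof (rule summable_theta_majorant)
    fix u v :: real assume "u > 0" "v > 0"
    then show "norm (u ^ k * exp (- (c * (u * v)))) \<le> fact (k + 2) / c ^ (k + 2) * (u powr - 2 * v powr - real (k + 2))"
      using exp_minus_le_powr[of c u v k] assms by (simp add: abs_mult)
  qed (use assms in auto)
  show "norm (theta_kernel (\<lambda>u v. u ^ k * exp (- (c * (u * v)))) \<theta> \<psi> x)
     \<le> theta_majorant (\<lambda>u v. norm (u ^ k * exp (- (c * (u * v))))) \<theta> \<psi> x" for x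
    by (rule norm_theta_kernel_le)
qed simp

text \<open>The double series \<open>b\<close> links the two sides. Summed over n first, it is the
  forward formula and gives 1/k! times the series on the left; summed over e first, it is the
  backward formula and gives the kernel, again with 1/k!, which cancels. All three double series are
  summable, so they may be summed iteratively, and \<open>b\<close> in both orders.\<close>

lemma theta_identity:
  assumes s: "s > 0" and \<theta>: "0 < \<theta>" "\<theta> < 1" and \<psi>: "0 < \<psi>" "\<psi> < 1" and k: "even k" "k \<ge> 2"
  shows "((\<lambda>(d, e). real d ^ k * cos (2 * pi * real d * \<theta>) * sin (2 * pi * real e * \<psi>) * exp (- (s * (real d * real e)))) has_sum
     ((- 1) ^ (k div 2) * (2 * pi / s) ^ (k + 1) / 4 *
        (\<Sum>\<^sub>\<infinity>x. theta_kernel (\<lambda>u v. u ^ k * exp (- (4 * pi\<^sup>2 / s * (u * v)))) \<theta> \<psi> x))) UNIV"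
proof -
  define a where "a = (\<lambda>(d, e). real d ^ k * cos (2 * pi * real d * \<theta>) * sin (2 * pi * real e * \<psi>) * exp (- (s * (real d * real e))))"
  define Sd where "Sd = (\<lambda>w. \<Sum>\<^sub>\<infinity>d. real d ^ k * cos (2 * pi * real d * \<theta>) * exp (- (real d * w)))"
  define b where "b = (\<lambda>(e, n). sin (2 * pi * real e * \<psi>) * (cauchy_re k (real e * s) (real n + \<theta>) + cauchy_re k (real e * s) (real n + 1 - \<theta>)))"
  define K where "K = theta_kernel (\<lambda>u v. u ^ k * exp (- (4 * pi\<^sup>2 / s * (u * v)))) \<theta> \<psi>"
  define O' where "O' = (\<lambda>v. odd_lerch k \<psi> (4 * pi\<^sup>2 * v / s))"
  define c where "c = (- 1) ^ (k div 2) * (2 * pi / s) ^ (k + 1) / (4 * fact k)"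
  define q where "q = real (k + 1) / 2"
  \<comment> \<open>The exponent (k+1)/2 exceeds 1 exactly when k >= 2; at k = 1 the majorant of
    \<open>b\<close> would already diverge.\<close>
  have q: "q > 1" using k by (simp add: q_def)

  have "(\<lambda>x. norm (b x)) summable_on UNIV \<times> UNIV"
  proof (rule abs_summable_on_Times_bound)
    define C where "C = (4 * pi) powr - q * s powr - q"
    show "(\<lambda>e. C * (real e + 0) powr - q) summable_on UNIV"
      using q by (intro summable_on_cmult_right summable_on_shifted_powr) auto
    show "(\<lambda>n. (real n + \<theta>) powr - q + (real n + (1 - \<theta>)) powr - q) summable_on UNIV"
      using q \<theta> by (intro summable_on_add summable_on_shifted_powr) auto
    fix e n :: nat
    show "norm (b (e, n)) \<le> C * (real e + 0) powr - q * ((real n + \<theta>) powr - q + (real n + (1 - \<theta>)) powr - q)"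
    proof (cases "e = 0")
      case False
      have R: "\<bar>cauchy_re k (real e * s) v\<bar> \<le> C * (real e + 0) powr - q * v powr - q" if "v > 0" for v
        using abs_cauchy_re_le[of "real e * s" v k] that False s
        by (simp add: C_def q_def powr_mult mult_ac)
      have "norm (b (e, n)) = \<bar>sin (2 * pi * real e * \<psi>)\<bar> *
          \<bar>cauchy_re k (real e * s) (real n + \<theta>) + cauchy_re k (real e * s) (real n + (1 - \<theta>))\<bar>"
        by (simp add: b_def abs_mult add_diff_eq)
      also have "\<dots> \<le> 1 * (\<bar>cauchy_re k (real e * s) (real n + \<theta>)\<bar> + \<bar>cauchy_re k (real e * s) (real n + (1 - \<theta>))\<bar>)"
        by (intro mult_mono abs_sin_le_one abs_triangle_ineq) auto
      also have "\<dots> \<le> C * (real e + 0) powr - q * ((real n + \<theta>) powr - q + (real n + (1 - \<theta>)) powr - q)"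
        unfolding distrib_left mult_1 using \<theta> by (intro add_mono R) auto
      finally show ?thesis .
    qed (simp add: b_def)
  qed auto
  then have "b summable_on UNIV \<times> UNIV"
    by (rule abs_summable_summable)
  then obtain B where B: "(b has_sum B) (UNIV \<times> UNIV)"
    unfolding summable_on_def by blast

  have "((\<lambda>n. b (e, n)) has_sum sin (2 * pi * real e * \<psi>) * (Sd (real e * s) / fact k)) UNIV" for e
  \<comment> \<open>At e = 0 the argument w = e s of the forward formula is 0, outside its range;
    the sine annihilates this row whatever value \<open>Sd 0\<close> has.\<close>
  proof (cases "e = 0")
    case False
    then show ?thesis
      unfolding b_def prod.case Sd_def using s k by (intro has_sum_cmult_right has_sum_cos_exp) auto
  qed (simp add: b_def)
  with B have "((\<lambda>e. sin (2 * pi * real e * \<psi>) * (Sd (real e * s) / fact k)) has_sum B) UNIV"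
    by (rule has_sum_SigmaD)
  from has_sum_cmult_right[OF this, of "fact k"]
  have rowB: "((\<lambda>e. sin (2 * pi * real e * \<psi>) * Sd (real e * s)) has_sum fact k * B) UNIV"
    by simp

  have "((\<lambda>(n, e). b (e, n)) has_sum B) (UNIV \<times> UNIV)"
    using B by (subst (asm) has_sum_swap)
  then have colB: "((\<lambda>n. c * O' (real n + \<theta>) + c * O' (real n + 1 - \<theta>)) has_sum B) UNIV"
  proof (rule has_sum_SigmaD)
    fix n
    show "((\<lambda>e. (\<lambda>(n, e). b (e, n)) (n, e)) has_sum (c * O' (real n + \<theta>) + c * O' (real n + 1 - \<theta>))) UNIV"
      unfolding b_def prod.case O'_def c_def distrib_left[of "sin _"]
      by (intro has_sum_add has_sum_sin_cauchy_re) (use s \<theta> \<psi> k in auto)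
  qed

  have "K summable_on UNIV \<times> UNIV"
    unfolding K_def UNIV_Times_UNIV using s by (intro summable_theta_kernel_exp \<theta> \<psi>) simp
  then have K: "(K has_sum infsum K UNIV) (UNIV \<times> UNIV)"
    using has_sum_infsum by fastforce
  then have "((\<lambda>m. O' (real m + \<theta>) + O' (real m + 1 - \<theta>)) has_sum infsum K UNIV) UNIV"
  proof (rule has_sum_SigmaD)
    fix m :: nat
    have "((\<lambda>n. (real n + \<psi>) ^ k * exp (- (4 * pi\<^sup>2 / s * ((real n + \<psi>) * v)))
         - (real n + 1 - \<psi>) ^ k * exp (- (4 * pi\<^sup>2 / s * ((real n + 1 - \<psi>) * v)))) has_sum O' v) UNIV" if "v > 0" for v
      using has_sum_odd_lerch[of "4 * pi\<^sup>2 * v / s" \<psi> k] that s \<psi> by (simp add: O'_def mult_ac)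
    from has_sum_add[OF this[of "real m + \<theta>"] this[of "real m + 1 - \<theta>"]]
    show "((\<lambda>n. K (m, n)) has_sum (O' (real m + \<theta>) + O' (real m + 1 - \<theta>))) UNIV"
      using \<theta> unfolding K_def theta_kernel_def prod.case by (simp add: algebra_simps)
  qed
  from has_sum_cmult_right[OF this, of c] colB have "B = c * infsum K UNIV"
    unfolding distrib_left using has_sum_unique by blast

  moreover have "(\<lambda>x. norm (a x)) summable_on UNIV"
    using abs_summable_cos_sin_exp[OF s, of k \<theta> \<psi>] k by (simp add: a_def)
  then have "a summable_on UNIV"
    by (rule abs_summable_summable)
  then have a: "(a has_sum infsum a UNIV) UNIV"
    by (rule has_sum_infsum)
  then have "((\<lambda>(e, d). a (d, e)) has_sum infsum a UNIV) (UNIV \<times> UNIV)"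
    by (subst has_sum_swap[symmetric]) simp
  then have "((\<lambda>e. sin (2 * pi * real e * \<psi>) * Sd (real e * s)) has_sum infsum a UNIV) UNIV"
  proof (rule has_sum_SigmaD)
    fix e :: nat
    have "((\<lambda>d. sin (2 * pi * real e * \<psi>) * (real d ^ k * cos (2 * pi * real d * \<theta>) * exp (- (real d * (real e * s)))))
        has_sum sin (2 * pi * real e * \<psi>) * Sd (real e * s)) UNIV"
    proof (cases "e = 0")
      case False
      have "(\<lambda>d. real d ^ k * cos (2 * pi * real d * \<theta>) * exp (- (real d * (real e * s)))) summable_on UNIV"
      proof (rule norm_summable_imp_summable_on, rule summable_comparison_test'[OF summable_power_exp])
        show "real e * s > 0" using False s by simp
        fix d :: nat
        have "\<bar>cos (2 * pi * real d * \<theta>)\<bar> * (real d ^ k * exp (- (real d * (real e * s)))) \<le> 1 * (real (d + 1) ^ k * exp (- (real d * (real e * s))))"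
          by (intro mult_mono power_mono) auto
        then show "norm (norm (real d ^ k * cos (2 * pi * real d * \<theta>) * exp (- (real d * (real e * s))))) \<le> real (d + 1) ^ k * exp (- (real d * (real e * s)))"
          by (simp add: abs_mult mult_ac)
      qed
      then show ?thesis unfolding Sd_def by (intro has_sum_cmult_right has_sum_infsum)
    qed simp
    then show "((\<lambda>d. (\<lambda>(e, d). a (d, e)) (e, d)) has_sum sin (2 * pi * real e * \<psi>) * Sd (real e * s)) UNIV"
      by (simp add: a_def mult_ac)
  qed
  with rowB have "infsum a UNIV = fact k * B" using has_sum_unique by blast
  ultimately have "infsum a UNIV = (- 1) ^ (k div 2) * (2 * pi / s) ^ (k + 1) / 4 * infsum K UNIV"
    by (simp add: c_def)
  with a show ?thesis unfolding a_def K_def by simp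
qed

text \<open>At \<open>n = 0\<close> the divisor set is infinite, so the inner sum is \<open>0\<close> there.\<close>
lemma has_sum_divisors:
  fixes a :: "nat \<Rightarrow> nat \<Rightarrow> 'a::{topological_comm_monoid_add, t3_space}"
  assumes a: "((\<lambda>(d, e). a d e) has_sum S) UNIV"
    and zero: "\<And>d. a d 0 = 0" "\<And>e. a 0 e = 0"
  shows "((\<lambda>n. \<Sum>d | d dvd n. a d (n div d)) has_sum S) UNIV"
proof -
  have "((\<lambda>(d, e). a d e) has_sum S) ({1..} \<times> {1..})"
    using a by (rule has_sum_cong_neutral[THEN iffD1, rotated -1]) (use zero in \<open>auto simp: Suc_le_eq intro!: gr0I\<close>)
  \<comment> \<open>On positive pairs, (d, e) -> (d e, d) is a bijection onto the pairs (n, d) with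
    n positive and d a divisor of n, and these divisor sets are finite.\<close>
  then have "((\<lambda>(n, d). a d (n div d)) has_sum S) (Sigma {1..} (\<lambda>n. {d. d dvd n}))"
    by (rule has_sum_reindex_bij_witness[where i = "\<lambda>(n, d). (d, n div d)" and j = "\<lambda>(d, e). (d * e, d)",
          THEN iffD1, rotated -1]) auto
  then have "((\<lambda>n. \<Sum>d | d dvd n. a d (n div d)) has_sum S) {1..}"
    by (rule has_sum_SigmaD) (auto intro!: has_sum_finiteI finite_divisors_nat)
  then show ?thesis
    by (rule has_sum_cong_neutral[THEN iffD1, rotated -1]) (auto simp: not_le intro!: sum.infinite)
qed

section \<open>Integral representations\<close>

text \<open>The enumeration e reduces unordered sums to series, for which termwise integration
  holds. It is instantiated with the identity for the sum over n and with \<open>prod_decode\<close>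
  for pairs.\<close>

lemma has_sum_lebesgue_integral:
  fixes f :: "'i \<Rightarrow> 'a \<Rightarrow> complex"
  assumes e: "bij (e :: nat \<Rightarrow> 'i)"
    and f: "\<And>i. integrable M (f i)"
    and D: "D summable_on UNIV" "\<And>i. (\<integral>x. norm (f i x) \<partial>M) \<le> D i"
    and F: "\<And>x. x \<in> space M \<Longrightarrow> ((\<lambda>i. f i x) has_sum F x) UNIV"
  shows "((\<lambda>i. \<integral>x. f i x \<partial>M) has_sum (\<integral>x. F x \<partial>M)) UNIV"
proof -
  have sums: "(\<lambda>n. f (e n) x) sums F x" "summable (\<lambda>n. norm (f (e n) x))" if "x \<in> space M" for x
  proof -
    have *: "((\<lambda>n. f (e n) x) has_sum F x) UNIV"
      using F[OF that] has_sum_reindex_bij_betw[OF e, of "\<lambda>i. f i x"] by simp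
    then show "(\<lambda>n. f (e n) x) sums F x" by (rule has_sum_imp_sums)
    \<comment> \<open>For complex values unordered summability already implies absolute summability,
      so \<open>F\<close> yields the pointwise hypothesis of \<open>sums_integral\<close>.\<close>
    have "(\<lambda>n. norm (f (e n) x)) summable_on UNIV"
      by (rule summable_on_iff_abs_summable_on_complex[THEN iffD1, OF has_sum_imp_summable[OF *]])
    then show "summable (\<lambda>n. norm (f (e n) x))" by (rule summable_on_imp_summable)
  qed
  have "summable (\<lambda>n. D (e n))"
    using D(1) summable_on_reindex_bij_betw[OF e, of D] by (intro summable_on_imp_summable) simp
  then have int: "summable (\<lambda>n. \<integral>x. norm (f (e n) x) \<partial>M)"
    by (rule summable_comparison_test') (use D(2) in auto)
  have "(\<lambda>n. \<integral>x. f (e n) x \<partial>M) sums (\<integral>x. (\<Sum>n. f (e n) x) \<partial>M)"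
    by (rule sums_integral) (use f int sums(2) in auto)
  also have "(\<integral>x. (\<Sum>n. f (e n) x) \<partial>M) = (\<integral>x. F x \<partial>M)"
    using sums(1) by (intro Bochner_Integration.integral_cong) (auto simp: sums_iff)
  finally have "((\<lambda>n. \<integral>x. f (e n) x \<partial>M) has_sum (\<integral>x. F x \<partial>M)) UNIV"
  proof (rule norm_summable_imp_has_sum[rotated])
    show "summable (\<lambda>n. norm (\<integral>x. f (e n) x \<partial>M))"
      by (rule summable_comparison_test'[OF int]) (simp add: integral_norm_bound)
  qed
  then show ?thesis
    using has_sum_reindex_bij_betw[OF e, of "\<lambda>i. \<integral>x. f i x \<partial>M"] by simp
qed

section \<open>Gamma integrals on the whole line\<close>

lemma has_bochner_integral_Gamma_exp:
  assumes "Re \<mu> > 0"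
  shows "has_bochner_integral lborel (\<lambda>t::real. exp (\<mu> * of_real t - of_real (exp t))) (Gamma \<mu>)"
proof -
  define f where "f = (\<lambda>t. complex_of_real t powr (\<mu> - 1) / of_real (exp t))"
  have r: "range (exp :: real \<Rightarrow> real) = {0<..}"
    by (auto simp: image_iff intro!: exp_ln[symmetric])
  have "f absolutely_integrable_on {0<..} \<and> integral {0<..} f = Gamma \<mu>"
    unfolding f_def using absolutely_integrable_Gamma_integral'[OF assms] Gamma_integral_complex'[OF assms]
    by (simp add: integral_unique)
  \<comment> \<open>Substituting exp x in Euler's integral; the Jacobian exp x raises the exponent
    \<mu> - 1 to \<mu>.\<close>
  then have *: "(\<lambda>x. \<bar>exp x\<bar> *\<^sub>R f (exp x)) absolutely_integrable_on UNIV \<and>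
      integral UNIV (\<lambda>x. \<bar>exp x\<bar> *\<^sub>R f (exp x)) = Gamma \<mu>"
    unfolding r[symmetric]
    by (subst has_absolute_integral_change_of_variables_real) (auto intro!: derivative_eq_intros simp: inj_on_def)
  have eq: "\<bar>exp x\<bar> *\<^sub>R f (exp x) = exp (\<mu> * of_real x - of_real (exp x))" for x
    by (simp add: f_def powr_def scaleR_conv_of_real exp_diff Ln_of_real exp_of_real algebra_simps flip: exp_add)
  have m: "(\<lambda>x::real. exp (\<mu> * of_real x - of_real (exp x))) \<in> borel_measurable lborel"
    by measurable
  from * have "integrable lebesgue (\<lambda>x::real. exp (\<mu> * of_real x - of_real (exp x)))"
    unfolding eq set_integrable_def by simp
  then have i: "integrable lborel (\<lambda>x::real. exp (\<mu> * of_real x - of_real (exp x)))"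
    using integrable_completion[OF m] by simp
  then show ?thesis
    using * integral_lborel[OF i] unfolding eq by (simp add: has_bochner_integral_iff)
qed

text \<open>Translate the variable by ln b: this puts b in front of exp t and releases the factor b
  powr \<mu>.\<close>

lemma has_bochner_integral_Gamma_exp_scaled:
  assumes \<mu>: "Re \<mu> > 0" and b: "b > 0"
  shows "has_bochner_integral lborel (\<lambda>t::real. exp (\<mu> * of_real t - of_real (b * exp t))) (Gamma \<mu> / of_real b powr \<mu>)"
proof -
  have "has_bochner_integral lborel (\<lambda>t::real. exp (\<mu> * of_real (ln b + 1 * t) - of_real (exp (ln b + 1 * t)))) (Gamma \<mu> /\<^sub>R \<bar>1\<bar>)"
    using has_bochner_integral_Gamma_exp[OF \<mu>] by (subst (asm) lborel_has_bochner_integral_real_affine_iff[of 1 _ _ "ln b"]) auto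
  then have "has_bochner_integral lborel (\<lambda>t::real. exp (\<mu> * of_real (ln b + 1 * t) - of_real (exp (ln b + 1 * t))) / of_real b powr \<mu>) (Gamma \<mu> / of_real b powr \<mu>)"
    by (intro has_bochner_integral_divide) simp
  moreover have "exp (\<mu> * of_real (ln b + 1 * t) - of_real (exp (ln b + 1 * t))) / of_real b powr \<mu> = exp (\<mu> * of_real t - of_real (b * exp t))" for t
    using b by (simp add: powr_def exp_add ring_distribs Ln_of_real flip: exp_diff)
  ultimately show ?thesis by simp
qed

lemma has_bochner_integral_Gamma_exp_scaled_real:
  fixes \<sigma> b :: real
  assumes "\<sigma> > 0" "b > 0"
  shows "has_bochner_integral lborel (\<lambda>t. exp (\<sigma> * t - b * exp t)) (Gamma \<sigma> / b powr \<sigma>)"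
proof -
  have "has_bochner_integral lborel (\<lambda>t. Re (exp (of_real \<sigma> * of_real t - of_real (b * exp t)))) (Re (Gamma (of_real \<sigma>) / of_real b powr of_real \<sigma>))"
    using assms by (intro has_bochner_integral_Re has_bochner_integral_Gamma_exp_scaled) auto
  moreover have "Re (exp (of_real \<sigma> * of_real t - of_real (b * exp t))) = exp (\<sigma> * t - b * exp t)" for t
    by (simp only: of_real_mult[symmetric] of_real_diff[symmetric] exp_of_real Re_complex_of_real)
  moreover have "Re (Gamma (of_real \<sigma>) / of_real b powr of_real \<sigma>) = Gamma \<sigma> / b powr \<sigma>"
    using assms by (simp add: Gamma_complex_of_real powr_of_real flip: of_real_divide)
  ultimately show ?thesis by simp
qed

section \<open>Bessel functions as integrals over the line\<close>

lemma integrable_exp_double: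
  assumes \<nu>: "Re \<nu> > 0" and c: "c \<ge> 0"
  shows "integrable lborel (\<lambda>t::real. exp (\<nu> * of_real t - of_real (exp t) - of_real (c * exp (- t))))"
proof (rule Bochner_Integration.integrable_bound)
  show "integrable lborel (\<lambda>t::real. exp (\<nu> * of_real t - of_real (exp t)))"
    using has_bochner_integral_Gamma_exp[OF \<nu>] by (simp add: has_bochner_integral_iff)
  show "AE t in lborel. norm (exp (\<nu> * of_real t - of_real (exp t) - of_real (c * exp (- t)))) \<le> norm (exp (\<nu> * of_real t - of_real (exp t)))"
    using c by (intro AE_I2) (simp add: norm_exp_eq_Re)
qed measurable

text \<open>Translating by ln h balances the exponentials: exp t + h^2 exp (-t) becomes 2 h cosh t,
  and exp (\<nu> t) releases h powr \<nu>. Averaging with the reflection t -> -t turns exp (\<nu> t)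
  into cosh (\<nu> t). The integrand is then even, so the line integral is twice
  \<open>besselK\<close>.\<close>

lemma besselK_eq_integral:
  assumes \<nu>: "Re \<nu> > 0" and h: "h > 0"
  shows "of_real h powr \<nu> * besselK \<nu> (2 * h)
     = 1 / 2 * (\<integral>t. exp (\<nu> * of_real t - of_real (exp t) - of_real (h\<^sup>2 * exp (- t))) \<partial>lborel)"
proof -
  define G where "G = (\<lambda>t::real. exp (\<nu> * of_real t - of_real (exp t) - of_real (h\<^sup>2 * exp (- t))))"
  define P where "P = (\<lambda>t::real. exp (\<nu> * of_real t - of_real (2 * h * cosh t)))"
  define Q where "Q = (\<lambda>t::real. exp (- (2 * h) * cosh t) *\<^sub>R cosh (\<nu> * of_real t))"
  have "has_bochner_integral lborel G (integral\<^sup>L lborel G)"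
    unfolding G_def by (intro has_bochner_integral_integrable integrable_exp_double \<nu>) auto
  then have "has_bochner_integral lborel (\<lambda>t. G (ln h + 1 * t)) (integral\<^sup>L lborel G /\<^sub>R \<bar>1\<bar>)"
    by (subst (asm) lborel_has_bochner_integral_real_affine_iff[of 1 _ _ "ln h"]) auto
  moreover have "G (ln h + 1 * t) = of_real h powr \<nu> * P t" for t
  proof -
    have "\<nu> * of_real (ln h + 1 * t) - of_real (exp (ln h + 1 * t)) - of_real (h\<^sup>2 * exp (- (ln h + 1 * t)))
       = \<nu> * of_real (ln h) + (\<nu> * of_real t - of_real (2 * h * cosh t))"
      using h by (simp add: exp_add exp_diff exp_minus cosh_field_def field_simps power2_eq_square)
    then show ?thesis using h by (simp add: G_def P_def powr_def Ln_of_real exp_add)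
  qed
  ultimately have "has_bochner_integral lborel (\<lambda>t. of_real h powr \<nu> * P t) (integral\<^sup>L lborel G)"
    by simp
  then have "has_bochner_integral lborel (\<lambda>t. of_real h powr \<nu> * P t / of_real h powr \<nu>) (integral\<^sup>L lborel G / of_real h powr \<nu>)"
    by (rule has_bochner_integral_divide)
  then have P: "has_bochner_integral lborel P (integral\<^sup>L lborel G / of_real h powr \<nu>)"
    using h by simp
  then have "has_bochner_integral lborel (\<lambda>t. P (0 + (- 1) * t)) ((integral\<^sup>L lborel G / of_real h powr \<nu>) /\<^sub>R \<bar>- 1\<bar>)"
    by (subst (asm) lborel_has_bochner_integral_real_affine_iff[of "- 1" _ _ 0]) auto
  with P have "has_bochner_integral lborel (\<lambda>t. (P t + P (- t)) / 2) ((integral\<^sup>L lborel G / of_real h powr \<nu> + integral\<^sup>L lborel G / of_real h powr \<nu>) / 2)"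
    by (intro has_bochner_integral_divide has_bochner_integral_add) auto
  moreover have "(P t + P (- t)) / 2 = Q t" for t
  proof -
    have "Q t = of_real (exp (- (2 * h * cosh t))) * ((exp (\<nu> * of_real t) + exp (- (\<nu> * of_real t))) / 2)"
      by (simp add: Q_def scaleR_conv_of_real cosh_def)
    moreover have "P t = of_real (exp (- (2 * h * cosh t))) * exp (\<nu> * of_real t)" for t
      unfolding P_def exp_of_real[symmetric] exp_add[symmetric] by (intro arg_cong[of _ _ exp]) simp
    ultimately show ?thesis by (simp add: algebra_simps)
  qed
  ultimately have Q: "has_bochner_integral lborel Q (integral\<^sup>L lborel G / of_real h powr \<nu>)"
    by simp
  have si: "set_integrable lborel {0..} Q"
    using Q unfolding set_integrable_def
    by (intro integrable_mult_indicator) (auto simp: has_bochner_integral_iff)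
  have "(LINT t:{0..}|lborel. Q t) = besselK \<nu> (2 * h)"
    using set_borel_integral_eq_integral(2)[OF si] by (simp add: besselK_def Q_def)
  then have "has_bochner_integral lborel (\<lambda>t. indicator {0..} t *\<^sub>R Q t) (besselK \<nu> (2 * h))"
    using si unfolding set_integrable_def set_lebesgue_integral_def by (simp add: has_bochner_integral_iff)
  then have "has_bochner_integral lborel Q (2 *\<^sub>R besselK \<nu> (2 * h))"
    by (rule has_bochner_integral_even_function) (simp add: Q_def)
  with Q have "integral\<^sup>L lborel G / of_real h powr \<nu> = 2 *\<^sub>R besselK \<nu> (2 * h)"
    by (rule has_bochner_integral_eq)
  then show ?thesis using h by (simp add: G_def scaleR_conv_of_real field_simps)
qed

lemma besselK_sqrt_eq_integral:
  assumes \<nu>: "Re \<nu> > 0" and "a > 0" "x > 0" "n > 0"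
  defines "X \<equiv> a\<^sup>2 * x / 4"
  shows "of_nat n powr (\<nu> / 2) * besselK \<nu> (a * sqrt (real n * x))
     = of_real X powr (- \<nu> / 2) / 2 * (\<integral>t. exp (\<nu> * of_real t - of_real (exp t) - of_real (real n * X * exp (- t))) \<partial>lborel)"
proof -
  \<comment> \<open>Chosen so that 2 h is the Bessel argument a sqrt (n x). Then h powr \<nu>
    contains precisely the weight n powr (\<nu>/2) of the series.\<close>
  define h where "h = sqrt (real n * X)"
  have X: "X > 0" using assms by (simp add: X_def)
  have h: "h > 0" "h\<^sup>2 = real n * X" using X assms by (auto simp: h_def)
  have "2 * h = a * sqrt (real n * x)"
    using assms by (simp add: h_def X_def real_sqrt_mult real_sqrt_divide)
  moreover have "of_real h powr \<nu> = of_nat n powr (\<nu> / 2) * of_real X powr (\<nu> / 2)"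
  proof -
    have lnh: "ln h = (ln (real n) + ln X) / 2"
      using X \<open>n > 0\<close> by (simp add: h_def ln_sqrt ln_mult)
    have eq: "\<nu> * of_real (ln h) = \<nu> / 2 * of_real (ln (real n)) + \<nu> / 2 * of_real (ln X)"
      unfolding lnh by (simp add: field_simps)
    have powr: "complex_of_real r powr z = exp (z * of_real (ln r))" if "r > 0" for r z
      using that by (simp add: powr_def Ln_of_real)
    have "(of_nat n :: complex) = of_real (real n)" by simp
    then show ?thesis
      using powr[OF h(1), of \<nu>] powr[OF X, of "\<nu> / 2"] powr[of "real n" "\<nu> / 2"] \<open>n > 0\<close> eq
      by (simp only: exp_add of_nat_0_less_iff)
  qed
  moreover have "of_real X powr (\<nu> / 2) * of_real X powr (- \<nu> / 2) = 1"
    using X by (simp add: powr_add[symmetric] flip: powr_add)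
  ultimately have "of_nat n powr (\<nu> / 2) * besselK \<nu> (a * sqrt (real n * x))
      = of_real X powr (- \<nu> / 2) * (of_real h powr \<nu> * besselK \<nu> (2 * h))"
    by (simp add: mult_ac)
  then show ?thesis unfolding besselK_eq_integral[OF \<nu> h(1)] h(2) by simp
qed

section \<open>Divisor sums and their termwise integration\<close>

lemma has_sum_divisor_sum_exp:
  fixes \<theta> \<psi> s :: real and k :: nat
  defines "A \<equiv> (\<lambda>n. \<Sum>d | d dvd n. real d ^ k * cos (2 * pi * real d * \<theta>) * sin (2 * pi * real n * \<psi> / real d))"
  assumes s: "s > 0" and \<theta>: "0 < \<theta>" "\<theta> < 1" and \<psi>: "0 < \<psi>" "\<psi> < 1" and k: "even k" "k \<ge> 2"
  shows "((\<lambda>n. A n * exp (- (s * real n))) has_sum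
     ((- 1) ^ (k div 2) * (2 * pi / s) ^ (k + 1) / 4 *
        (\<Sum>\<^sub>\<infinity>x. theta_kernel (\<lambda>u v. u ^ k * exp (- (4 * pi\<^sup>2 / s * (u * v)))) \<theta> \<psi> x))) UNIV"
proof -
  define a where "a = (\<lambda>d e. real d ^ k * cos (2 * pi * real d * \<theta>) * sin (2 * pi * real e * \<psi>) * exp (- (s * (real d * real e))))"
  have "(\<Sum>d | d dvd n. a d (n div d)) = A n * exp (- (s * real n))" for n
  proof (cases "n = 0")
    case False
    have "a d (n div d) = real d ^ k * cos (2 * pi * real d * \<theta>) * sin (2 * pi * real n * \<psi> / real d) * exp (- (s * real n))"
      if "d dvd n" for d
    proof -
      have "2 * pi * real n * \<psi> / real d = 2 * pi * real (n div d) * \<psi>"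
        using that by (simp add: real_of_nat_div mult_ac)
      moreover have "real d * real (n div d) = real n"
        using that by (simp flip: of_nat_mult)
      ultimately show ?thesis by (simp only: a_def)
    qed
    then show ?thesis by (simp add: A_def sum_distrib_right)
  qed (simp add: A_def)
  moreover have "((\<lambda>n. \<Sum>d | d dvd n. a d (n div d)) has_sum
     ((- 1) ^ (k div 2) * (2 * pi / s) ^ (k + 1) / 4 *
        (\<Sum>\<^sub>\<infinity>x. theta_kernel (\<lambda>u v. u ^ k * exp (- (4 * pi\<^sup>2 / s * (u * v)))) \<theta> \<psi> x))) UNIV"
    using theta_identity[OF s \<theta> \<psi> k] k by (intro has_sum_divisors) (auto simp: a_def)
  ultimately show ?thesis by simp
qed

text \<open>There are at most n divisors, each contributing at most n^k. This crude bound is enough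
  because the integral it multiplies decays faster than any power of n.\<close>

lemma abs_divisor_sum_le:
  "\<bar>\<Sum>d | d dvd n. real d ^ k * cos (\<alpha> d) * sin (\<beta> d)\<bar> \<le> real n ^ (k + 1)"
proof (cases "n = 0")
  case False
  have "\<bar>\<Sum>d | d dvd n. real d ^ k * cos (\<alpha> d) * sin (\<beta> d)\<bar> \<le> (\<Sum>d | d dvd n. real n ^ k)"
  proof (rule order_trans[OF sum_abs sum_mono])
    fix d assume "d \<in> {d. d dvd n}"
    then have "\<bar>cos (\<alpha> d)\<bar> * \<bar>sin (\<beta> d)\<bar> * real d ^ k \<le> 1 * real n ^ k"
      using False by (intro mult_mono mult_le_one power_mono) (auto dest: dvd_imp_le)
    then show "\<bar>real d ^ k * cos (\<alpha> d) * sin (\<beta> d)\<bar> \<le> real n ^ k"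
      by (simp add: abs_mult mult_ac)
  qed
  also have "\<dots> \<le> real n * real n ^ k"
  proof -
    have "{d. d dvd n} \<subseteq> {1..n}"
      using False by (auto dest: dvd_imp_le intro!: Suc_leI dvd_pos_nat[of n])
    then have "card {d. d dvd n} \<le> n"
      using card_mono[of "{1..n}"] by fastforce
    then show ?thesis by (auto intro!: mult_right_mono)
  qed
  finally show ?thesis by simp
qed simp

text \<open>Bounding exp (-c exp (-t)) by p! / (c exp (-t))^p trades a factor c^(-p) for an increase
  of the Gamma argument by p. With c = n X this gives arbitrary polynomial decay in n.\<close>

lemma integral_norm_exp_double_le:
  assumes \<nu>: "Re \<nu> > 0" and c: "c > 0"
  shows "(\<integral>t. norm (exp (\<nu> * of_real t - of_real (exp t) - of_real (c * exp (- t)))) \<partial>lborel) \<le> fact p / c ^ p * Gamma (Re \<nu> + real p)"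
proof -
  have G: "has_bochner_integral lborel (\<lambda>t. exp ((Re \<nu> + real p) * t - 1 * exp t)) (Gamma (Re \<nu> + real p) / 1 powr (Re \<nu> + real p))"
    using \<nu> by (intro has_bochner_integral_Gamma_exp_scaled_real) auto
  have "(\<integral>t. norm (exp (\<nu> * of_real t - of_real (exp t) - of_real (c * exp (- t)))) \<partial>lborel)
     \<le> (\<integral>t. fact p / c ^ p * exp ((Re \<nu> + real p) * t - 1 * exp t) \<partial>lborel)"
  proof (rule integral_mono)
    show "integrable lborel (\<lambda>t. norm (exp (\<nu> * of_real t - of_real (exp t) - of_real (c * exp (- t)))))"
      using c by (intro integrable_norm integrable_exp_double \<nu>) auto
    show "integrable lborel (\<lambda>t. fact p / c ^ p * exp ((Re \<nu> + real p) * t - 1 * exp t))"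
      using G by (intro integrable_mult_right) (simp add: has_bochner_integral_iff)
    fix t :: real
    have "norm (exp (\<nu> * of_real t - of_real (exp t) - of_real (c * exp (- t)))) = exp (Re \<nu> * t - exp t) * exp (- (c * exp (- t)))"
      by (simp add: norm_exp_eq_Re exp_add[symmetric])
    also have "\<dots> \<le> exp (Re \<nu> * t - exp t) * (fact p / (c * exp (- t)) ^ p)"
      using c by (intro mult_left_mono exp_minus_le_fact_div_power) auto
    also have "(c * exp (- t)) ^ p = c ^ p * exp (- (real p * t))"
      by (simp add: power_mult_distrib exp_of_nat_mult[symmetric])
    also have "exp (Re \<nu> * t - exp t) * (fact p / (c ^ p * exp (- (real p * t)))) = fact p / c ^ p * exp ((Re \<nu> + real p) * t - 1 * exp t)"
      by (simp add: exp_minus distrib_right exp_diff exp_add field_simps)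
    finally show "norm (exp (\<nu> * of_real t - of_real (exp t) - of_real (c * exp (- t)))) \<le> fact p / c ^ p * exp ((Re \<nu> + real p) * t - 1 * exp t)" .
  qed
  also have "\<dots> = fact p / c ^ p * Gamma (Re \<nu> + real p)"
    using G by (simp add: has_bochner_integral_iff)
  finally show ?thesis .
qed

text \<open>For each t the transformation formula at s = X exp (-t), multiplied by exp (\<nu> t -
  exp t), gives two expansions of one function \<open>F t\<close>: over n, and over pairs.
  Integrating both termwise and comparing yields the claim.\<close>

lemma has_sum_divisor_sum_besselK:
  fixes \<theta> \<psi> X :: real and k :: nat and \<nu> :: complex
  defines "A \<equiv> (\<lambda>n. \<Sum>d | d dvd n. real d ^ k * cos (2 * pi * real d * \<theta>) * sin (2 * pi * real n * \<psi> / real d))"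
  assumes X: "X > 0" and \<theta>: "0 < \<theta>" "\<theta> < 1" and \<psi>: "0 < \<psi>" "\<psi> < 1" and k: "even k" "k \<ge> 2"
    and \<nu>: "Re \<nu> > 0"
  shows "((\<lambda>n. of_real (A n) * (\<integral>t. exp (\<nu> * of_real t - of_real (exp t) - of_real (real n * X * exp (- t))) \<partial>lborel)) has_sum
     of_real ((- 1) ^ (k div 2) * (2 * pi / X) ^ (k + 1) / 4) * Gamma (\<nu> + of_nat k + 1) *
        (\<Sum>\<^sub>\<infinity>x. theta_kernel (\<lambda>u v. of_real (u ^ k) / of_real (4 * pi\<^sup>2 / X * (u * v) + 1) powr (\<nu> + of_nat k + 1)) \<theta> \<psi> x)) UNIV"
proof -
  define \<mu> where "\<mu> = \<nu> + of_nat k + 1"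
  define \<beta> where "\<beta> = 4 * pi\<^sup>2 / X"
  define c where "c = (- 1) ^ (k div 2) * (2 * pi / X) ^ (k + 1) / 4"
  define f where "f = (\<lambda>n t. of_real (A n) * exp (\<nu> * of_real t - of_real (exp t) - of_real (real n * X * exp (- t))))"
  define H where "H = (\<lambda>t u v. of_real (u ^ k) * exp (\<mu> * of_real t - of_real ((\<beta> * (u * v) + 1) * exp t)) :: complex)"
  define g where "g = (\<lambda>x t. theta_kernel (H t) \<theta> \<psi> x)"
  define J where "J = (\<lambda>u v. of_real (u ^ k) / of_real (\<beta> * (u * v) + 1) powr \<mu> :: complex)"
  define F where "F = (\<lambda>t. \<Sum>\<^sub>\<infinity>n. f n t)"
  have \<mu>: "Re \<mu> > 0" "Re \<mu> = Re \<nu> + real k + 1" using \<nu> by (auto simp: \<mu>_def)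
  have \<beta>: "\<beta> > 0" using X by (simp add: \<beta>_def)
  have c: "c \<noteq> 0" using X by (simp add: c_def)

  have sum: "((\<lambda>n. f n t) has_sum F t) UNIV \<and> ((\<lambda>x. of_real c * g x t) has_sum F t) UNIV" for t
  proof -
    define s where "s = X * exp (- t)"
    define K where "K = theta_kernel (\<lambda>u v. u ^ k * exp (- (4 * pi\<^sup>2 / s * (u * v)))) \<theta> \<psi>"
    have s: "s > 0" using X by (simp add: s_def)
    define C where "C = (- 1) ^ (k div 2) * (2 * pi / s) ^ (k + 1) / 4 * infsum K UNIV"
    have "((\<lambda>n. A n * exp (- (s * real n))) has_sum C) UNIV"
      unfolding A_def C_def K_def using has_sum_divisor_sum_exp[OF s \<theta> \<psi> k] by simp
    then have "((\<lambda>n. exp (\<nu> * of_real t - of_real (exp t)) * of_real (A n * exp (- (s * real n)))) has_sum (exp (\<nu> * of_real t - of_real (exp t)) * of_real C)) UNIV"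
      by (intro has_sum_cmult_right has_sum_of_real)
    moreover have "exp (\<nu> * of_real t - of_real (exp t)) * of_real (A n * exp (- (s * real n))) = f n t" for n
    proof -
      have "exp (\<nu> * of_real t - of_real (exp t)) * of_real (exp (- (s * real n)))
          = exp (\<nu> * of_real t - of_real (exp t) - of_real (real n * X * exp (- t)))"
        unfolding exp_of_real[symmetric] exp_add[symmetric]
        by (intro arg_cong[of _ _ exp]) (simp add: s_def)
      then show ?thesis unfolding f_def by (simp only: of_real_mult mult_ac)
    qed
    ultimately have f: "((\<lambda>n. f n t) has_sum (exp (\<nu> * of_real t - of_real (exp t)) * of_real C)) UNIV"
      by simp
    then have Ft: "F t = exp (\<nu> * of_real t - of_real (exp t)) * of_real C"
      unfolding F_def by (rule infsumI)
    have "K summable_on UNIV"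
      unfolding K_def using s by (intro summable_theta_kernel_exp \<theta> \<psi>) simp
    then have "((\<lambda>x. exp (\<nu> * of_real t - of_real (exp t)) * of_real ((- 1) ^ (k div 2) * (2 * pi / s) ^ (k + 1) / 4 * K x)) has_sum F t) UNIV"
      unfolding Ft C_def by (intro has_sum_cmult_right has_sum_of_real has_sum_infsum)
    moreover have "exp (\<nu> * of_real t - of_real (exp t)) * of_real ((- 1) ^ (k div 2) * (2 * pi / s) ^ (k + 1) / 4 * K x) = of_real c * g x t" for x
    proof -
      \<comment> \<open>The factor s^(-k-1) contributes exp ((k+1) t), which raises \<nu> to \<mu> =
        \<nu> + k + 1.\<close>
      have 1: "(- 1) ^ (k div 2) * (2 * pi / s) ^ (k + 1) / 4 = c * exp (real (k + 1) * t)"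
        by (simp only: c_def s_def exp_of_nat_mult exp_minus power_divide power_mult_distrib) (simp add: field_simps)
      have H_eq: "exp (\<nu> * of_real t - of_real (exp t)) * of_real (exp (real (k + 1) * t) * (u ^ k * exp (- (4 * pi\<^sup>2 / s * (u * v))))) = H t u v" for u v
      proof -
        have "4 * pi\<^sup>2 / s = \<beta> * exp t" using X by (simp add: s_def \<beta>_def exp_minus field_simps)
        then have "exp (\<nu> * of_real t - of_real (exp t)) * (exp (of_real (real (k + 1) * t)) * exp (of_real (- (4 * pi\<^sup>2 / s * (u * v)))))
            = exp (\<mu> * of_real t - of_real ((\<beta> * (u * v) + 1) * exp t))"
          unfolding exp_add[symmetric] by (intro arg_cong[of _ _ exp]) (simp add: \<mu>_def algebra_simps)
        then show ?thesis unfolding H_def exp_of_real by (simp add: mult_ac)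
      qed
      have "g x t = exp (\<nu> * of_real t - of_real (exp t)) * of_real (exp (real (k + 1) * t) * K x)"
        unfolding g_def K_def theta_kernel_def by (cases x) (simp only: prod.case of_real_mult of_real_add of_real_diff H_eq[symmetric], simp only: ring_distribs)
      then show ?thesis unfolding 1 by (simp add: mult_ac)
    qed
    ultimately have "((\<lambda>x. of_real c * g x t) has_sum F t) UNIV" by simp
    with f show ?thesis unfolding Ft by simp
  qed

  have fsum: "((\<lambda>n. \<integral>t. f n t \<partial>lborel) has_sum (\<integral>t. F t \<partial>lborel)) UNIV"
  proof (rule has_sum_lebesgue_integral[OF bij_id])
    \<comment> \<open>The exponent k + 3 exceeds the growth exponent k + 1 of the divisor sum by 2,
      leaving the summable n^(-2).\<close>
    define E where "E = fact (k + 3) / X ^ (k + 3) * Gamma (Re \<nu> + real (k + 3))"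
    show "integrable lborel (f n)" for n
      unfolding f_def using X by (intro integrable_mult_right integrable_exp_double \<nu>) auto
    show "(\<lambda>n. E * (real n + 0) powr - 2) summable_on UNIV"
      by (intro summable_on_cmult_right summable_on_shifted_powr) auto
    show "(\<integral>t. norm (f n t) \<partial>lborel) \<le> E * (real n + 0) powr - 2" for n
    proof (cases "n = 0")
      case False
      have "(\<integral>t. norm (f n t) \<partial>lborel) = \<bar>A n\<bar> * (\<integral>t. norm (exp (\<nu> * of_real t - of_real (exp t) - of_real (real n * X * exp (- t)))) \<partial>lborel)"
        by (simp add: f_def norm_mult)
      also have "\<dots> \<le> real n ^ (k + 1) * (fact (k + 3) / (real n * X) ^ (k + 3) * Gamma (Re \<nu> + real (k + 3)))"
        unfolding A_def using X False
        by (intro mult_mono abs_divisor_sum_le integral_norm_exp_double_le \<nu>) auto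
      also have "\<dots> = E * inverse (real n ^ 2)"
        using False X by (simp add: E_def power_mult_distrib power_add power2_eq_square power3_eq_cube field_simps del: fact_Suc)
      also have "inverse (real n ^ 2) = (real n + 0) powr - 2"
        using False by (simp add: powr_minus)
      finally show ?thesis .
    qed (simp add: f_def A_def)
  qed (use sum in auto)

  have int_H: "has_bochner_integral lborel (\<lambda>t. H t u v) (Gamma \<mu> * J u v)" if "u > 0" "v > 0" for u v
  proof -
    have "has_bochner_integral lborel (\<lambda>t. of_real (u ^ k) * exp (\<mu> * of_real t - of_real ((\<beta> * (u * v) + 1) * exp t)))
       (of_real (u ^ k) * (Gamma \<mu> / of_real (\<beta> * (u * v) + 1) powr \<mu>))"
      using that \<beta> \<mu> by (intro has_bochner_integral_mult_right has_bochner_integral_Gamma_exp_scaled) (auto intro!: add_nonneg_pos)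
    then show ?thesis unfolding H_def J_def by (simp add: mult_ac)
  qed
  have int_norm_H: "integrable lborel (\<lambda>t. norm (H t u v))" if "u > 0" "v > 0" for u v
    using int_H[OF that] by (auto simp: has_bochner_integral_iff)
  have pos: "real n + \<psi> > 0" "real n + 1 - \<psi> > 0" "real m + \<theta> > 0" "real m + 1 - \<theta> > 0" for m n
    using \<theta> \<psi> by auto
  have int_g: "has_bochner_integral lborel (g x) (Gamma \<mu> * theta_kernel J \<theta> \<psi> x)" for x
  proof -
    obtain m n where x: "x = (m, n)" by force
    show ?thesis
      unfolding x g_def theta_kernel_def prod.case ring_distribs
      by (intro has_bochner_integral_add has_bochner_integral_diff int_H pos)
  qed
  have gsum: "((\<lambda>x. \<integral>t. of_real c * g x t \<partial>lborel) has_sum (\<integral>t. F t \<partial>lborel)) UNIV"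
  proof (rule has_sum_lebesgue_integral[OF bij_prod_decode])
    define D where "D = (\<lambda>u v. \<integral>t. norm (H t u v) \<partial>lborel)"
    define \<sigma> where "\<sigma> = Re \<mu>"
    show "integrable lborel (\<lambda>t. of_real c * g x t)" for x
      using int_g[of x] by (intro integrable_mult_right) (simp add: has_bochner_integral_iff)
    show "(\<lambda>x. \<bar>c\<bar> * theta_majorant D \<theta> \<psi> x) summable_on UNIV"
    proof (intro summable_on_cmult_right summable_theta_majorant)
      fix u v :: real assume uv: "u > 0" "v > 0"
      have b: "\<beta> * (u * v) + 1 > 0" using uv \<beta> by (intro add_nonneg_pos) auto
      have "norm (H t u v) = u ^ k * exp (\<sigma> * t - (\<beta> * (u * v) + 1) * exp t)" for t
        using uv by (simp add: H_def \<sigma>_def norm_mult norm_power norm_exp_eq_Re)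
      moreover have "has_bochner_integral lborel (\<lambda>t. u ^ k * exp (\<sigma> * t - (\<beta> * (u * v) + 1) * exp t)) (u ^ k * (Gamma \<sigma> / (\<beta> * (u * v) + 1) powr \<sigma>))"
        using b \<mu> by (intro has_bochner_integral_mult_right has_bochner_integral_Gamma_exp_scaled_real) (auto simp: \<sigma>_def)
      ultimately have "D u v = u ^ k * Gamma \<sigma> * (\<beta> * (u * v) + 1) powr - \<sigma>"
        unfolding D_def by (simp add: has_bochner_integral_iff powr_minus divide_inverse)
      \<comment> \<open>Dropping the 1 separates u from v. With the factor u^k the exponent of u
        becomes -(\<sigma> - k) = -(Re \<nu> + 1), so summability in u rests on Re \<nu> > 0; v has
        the larger decay \<sigma>.\<close>
      also have "\<dots> \<le> u ^ k * Gamma \<sigma> * (\<beta> * (u * v)) powr - \<sigma>"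
        using uv \<beta> \<mu> by (intro mult_left_mono powr_mono2') (auto simp: \<sigma>_def)
      also have "\<dots> = Gamma \<sigma> * \<beta> powr - \<sigma> * (u powr - (\<sigma> - real k) * v powr - \<sigma>)"
        using uv \<beta> by (simp add: powr_mult powr_add[of u "- \<sigma>" "real k", simplified] powr_realpow)
      finally show "D u v \<le> Gamma \<sigma> * \<beta> powr - \<sigma> * (u powr - (\<sigma> - real k) * v powr - \<sigma>)" .
      show "0 \<le> D u v" unfolding D_def by simp
    qed (use \<theta> \<psi> \<mu> \<nu> in \<open>auto simp: \<sigma>_def\<close>)
    show "(\<integral>t. norm (of_real c * g x t) \<partial>lborel) \<le> \<bar>c\<bar> * theta_majorant D \<theta> \<psi> x" for x
    proof -
      obtain m n where x: "x = (m, n)" by force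
      have maj: "has_bochner_integral lborel (\<lambda>t. theta_majorant (\<lambda>u v. norm (H t u v)) \<theta> \<psi> x) (theta_majorant D \<theta> \<psi> x)"
        unfolding x theta_majorant_def prod.case D_def
        by (intro has_bochner_integral_add has_bochner_integral_integrable int_norm_H pos)
      have "(\<integral>t. norm (of_real c * g x t) \<partial>lborel) = \<bar>c\<bar> * (\<integral>t. norm (g x t) \<partial>lborel)"
        by (simp add: norm_mult)
      also have "(\<integral>t. norm (g x t) \<partial>lborel) \<le> (\<integral>t. theta_majorant (\<lambda>u v. norm (H t u v)) \<theta> \<psi> x \<partial>lborel)"
        using maj int_g[of x] unfolding g_def
        by (intro integral_mono integrable_norm norm_theta_kernel_le) (auto simp: has_bochner_integral_iff)
      also have "\<dots> = theta_majorant D \<theta> \<psi> x" using maj by (simp add: has_bochner_integral_iff)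
      finally show ?thesis by (simp add: mult_left_mono)
    qed
  qed (use sum in auto)
  have "(\<integral>t. of_real c * g x t \<partial>lborel) = of_real c * Gamma \<mu> * theta_kernel J \<theta> \<psi> x" for x
    using int_g[of x] by (simp add: has_bochner_integral_iff mult_ac)
  with gsum have "((\<lambda>x. of_real c * Gamma \<mu> * theta_kernel J \<theta> \<psi> x) has_sum (\<integral>t. F t \<partial>lborel)) UNIV"
    by (simp only:)
  then have "(\<integral>t. F t \<partial>lborel) = (\<Sum>\<^sub>\<infinity>x. of_real c * Gamma \<mu> * theta_kernel J \<theta> \<psi> x)"
    by (simp add: infsumI)
  also have "\<dots> = of_real c * Gamma \<mu> * infsum (theta_kernel J \<theta> \<psi>) UNIV"
    by (rule infsum_cmult_right')
  finally show ?thesis using fsum by (simp only: f_def c_def J_def \<mu>_def \<beta>_def integral_mult_right_zero)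
qed

theorem theorem2p15:
  fixes a x \<theta> \<psi> :: real and k :: nat and \<nu> :: complex
  assumes "a > 0" and "x > 0" and "0 < \<theta>" and "\<theta> < 1" and "0 < \<psi>" and "\<psi> < 1"
    and "even k" and "k \<ge> 2" and "Re \<nu> > 0"
  defines "c \<equiv> 16 * pi^2 / a^2"
  defines "T \<equiv> (\<lambda>u v::real. complex_of_real (u ^ k) /
                  (complex_of_real (c * (u * v) / x + 1)) powr (\<nu> + of_nat k + 1))"
  shows "complex_of_real (a^2 * x / 4) powr (\<nu> / 2 + of_nat k + 1) *
      (\<Sum>\<^sub>\<infinity>n\<in>{1::nat..}. of_nat n powr (\<nu> / 2) * besselK \<nu> (a * sqrt (real n * x)) *
          (\<Sum>d | d dvd n. complex_of_real (real d ^ k * cos (2 * pi * real d * \<theta>)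
                                * sin (2 * pi * real n * \<psi> / real d))))
    = (-1) ^ (k div 2) * (2 * pi) ^ (k + 1) / 8 * Gamma (\<nu> + of_nat k + 1) *
      (\<Sum>\<^sub>\<infinity>(m, n)\<in>(UNIV :: (nat \<times> nat) set).
          T (real n + \<psi>) (real m + \<theta>) - T (real n + 1 - \<psi>) (real m + \<theta>)
        - T (real n + 1 - \<psi>) (real m + 1 - \<theta>) + T (real n + \<psi>) (real m + 1 - \<theta>))"
proof -
  define X where "X = a\<^sup>2 * x / 4"
  define I where "I = (\<lambda>n. \<integral>t. exp (\<nu> * of_real t - of_real (exp t) - of_real (real n * X * exp (- t))) \<partial>lborel)"
  define A where "A = (\<lambda>n. \<Sum>d | d dvd n. real d ^ k * cos (2 * pi * real d * \<theta>) * sin (2 * pi * real n * \<psi> / real d))"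
  define S where "S = infsum (theta_kernel T \<theta> \<psi>) UNIV"
  have X: "X > 0" using assms(1,2) by (simp add: X_def)
  \<comment> \<open>Both forms agree because c / x = 16 pi^2 / (a^2 x) = 4 pi^2 / X.\<close>
  have T: "T = (\<lambda>u v. of_real (u ^ k) / of_real (4 * pi\<^sup>2 / X * (u * v) + 1) powr (\<nu> + of_nat k + 1))"
    using assms(1,2) by (simp add: T_def c_def X_def mult_ac)
  have "(\<Sum>\<^sub>\<infinity>n\<in>{1::nat..}. of_nat n powr (\<nu> / 2) * besselK \<nu> (a * sqrt (real n * x)) *
          (\<Sum>d | d dvd n. complex_of_real (real d ^ k * cos (2 * pi * real d * \<theta>) * sin (2 * pi * real n * \<psi> / real d))))
      = (\<Sum>\<^sub>\<infinity>n. of_real X powr (- \<nu> / 2) / 2 * (of_real (A n) * I n))"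
  proof (rule infsum_cong_neutral)
    fix n :: nat assume "n \<in> {1..} \<inter> UNIV"
    then have "of_nat n powr (\<nu> / 2) * besselK \<nu> (a * sqrt (real n * x)) = of_real X powr (- \<nu> / 2) / 2 * I n"
      unfolding I_def X_def using assms by (intro besselK_sqrt_eq_integral) auto
    then show "of_nat n powr (\<nu> / 2) * besselK \<nu> (a * sqrt (real n * x)) *
          (\<Sum>d | d dvd n. complex_of_real (real d ^ k * cos (2 * pi * real d * \<theta>) * sin (2 * pi * real n * \<psi> / real d)))
       = of_real X powr (- \<nu> / 2) / 2 * (of_real (A n) * I n)"
      by (simp only: A_def of_real_sum) (simp only: mult_ac)
  next
    fix n :: nat assume "n \<in> UNIV - {1..}"
    \<comment> \<open>Every natural number divides 0, and the sum over this infinite set is 0 by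
      convention; so the series may be extended from positive n to all naturals.\<close>
    then have "A n = 0" by (simp add: A_def not_le)
    then show "of_real X powr (- \<nu> / 2) / 2 * (of_real (A n) * I n) = 0" by simp
  qed simp
  also have "\<dots> = of_real X powr (- \<nu> / 2) / 2 * (of_real ((- 1) ^ (k div 2) * (2 * pi / X) ^ (k + 1) / 4) * Gamma (\<nu> + of_nat k + 1) * S)"
    unfolding infsum_cmult_right' I_def A_def S_def T
    using has_sum_divisor_sum_besselK[OF X assms(3-9)] by (intro arg_cong2[of _ _ _ _ "(*)"] refl infsumI)
  finally have "complex_of_real X powr (\<nu> / 2 + of_nat k + 1) *
      (\<Sum>\<^sub>\<infinity>n\<in>{1::nat..}. of_nat n powr (\<nu> / 2) * besselK \<nu> (a * sqrt (real n * x)) *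
          (\<Sum>d | d dvd n. complex_of_real (real d ^ k * cos (2 * pi * real d * \<theta>) * sin (2 * pi * real n * \<psi> / real d))))
     = (of_real X powr (\<nu> / 2 + of_nat k + 1) * of_real X powr (- \<nu> / 2)) *
       (1 / 2 * (of_real ((- 1) ^ (k div 2) * (2 * pi / X) ^ (k + 1) / 4) * Gamma (\<nu> + of_nat k + 1) * S))"
    by simp
  \<comment> \<open>The exponents \<nu>/2 cancel, and what remains is the integer power that removes
    X from (2 pi / X)^(k+1).\<close>
  also have "of_real X powr (\<nu> / 2 + of_nat k + 1) * of_real X powr (- \<nu> / 2) = of_real (X ^ (k + 1))"
  proof -
    have "of_real X powr (\<nu> / 2 + of_nat k + 1) * of_real X powr (- \<nu> / 2) = complex_of_real X powr of_nat (k + 1)"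
      unfolding powr_add[symmetric] by (simp add: algebra_simps)
    also have "\<dots> = of_real X ^ (k + 1)"
      using X by (subst powr_nat') auto
    finally show ?thesis by simp
  qed
  \<comment> \<open>The 8 is the 2 of the Bessel integral times the 4 of the transformation
    formula.\<close>
  also have "of_real (X ^ (k + 1)) * (1 / 2 * (of_real ((- 1) ^ (k div 2) * (2 * pi / X) ^ (k + 1) / 4) * Gamma (\<nu> + of_nat k + 1) * S))
     = (-1) ^ (k div 2) * (2 * pi) ^ (k + 1) / 8 * Gamma (\<nu> + of_nat k + 1) * S"
    using X by (simp add: power_divide)
  finally show ?thesis unfolding X_def S_def theta_kernel_def .
qed

end
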